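(* For the Rectilinear-Euclidean mixed TSPD model with drone speed factor $\alpha\ge1$, $$\beta_{\mathsf{TSPD}}\;\ge\;\max\left\{\frac{5}{4(\alpha+2)},\ \frac{1}{2e}\right\}.$$
   Context: Traveling Salesman Problem with Drone (TSPD). Let $\|\cdot\|_T$ (truck metric) and $\|\cdot\|_D$ (drone metric) be norms on $\mathbb{R}^2$, and let $\mathcal X\subset\mathbb{R}^2$ be a finite set of customer points (nodes). In a solution each node is exactly one of: a truck node (visited only by the truck), a drone node (served only by the drone), or a combined node (visited by both vehicles; a synchronization point). A ring $r$ is given by two distinct combined nodes serving as start and end nodes, together with at most one drone node and any number (possibly zero) of truck nodes between them. In ring $r$ the truck follows a path $\mathcal T_r$ from the start node through all truck nodes of the ring (in some order) to the end node, and, if a drone node is present, the drone follows the path $\mathcal D_r$ from the start node to the drone node to the end node. With $t(\mathcal T_r)$ the sum of the $\|\cdot\|_T$-lengths of the edges of $\mathcal T_r$ and $d(\mathcal D_r)$ the sum of the $\|\cdot\|_D$-lengths of the edges of $\mathcal D_r$, the cost $c(r)$ of the ring is the minimum, over the choices of $\mathcal T_r,\mathcal D_r$, of $\max\{t(\mathcal T_r),d(\mathcal D_r)\}$ if the ring contains a drone node, and of $t(\mathcal T_r)$ otherwise. A feasible solution for $\mathcal X$ is a set $\mathcal R(\mathcal X)$ of rings that together cover all points of $\mathcal X$ and are concatenated through their combined nodes to form a single cyclic tour; each point of $\mathcal X$ is served exactly once: a combined node is shared by exactly two adjacent rings, and every other point belongs to exactly one ring. The optimal makespan is $\mathsf{TSPD}(\mathcal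 X)=\min_{\mathcal R(\mathcal X)}\sum_{r\in\mathcal R(\mathcal X)}c(r)$. Conventions: $\mathsf{TSPD}(\mathcal X)=0$ if $|\mathcal X|\le1$, and $\mathsf{TSPD}(\{x,y\})=2\|x-y\|_T$ for $x\ne y$. Rectilinear-Euclidean mixed model: $\|p\|_T=\|p\|_1$ ($\ell_1$-norm) and $\|p\|_D=\frac1\alpha\|p\|_2$, where $\alpha\ge1$. Asymptotic constant: for $X_1,X_2,\ldots$ i.i.d. uniform on $[0,1]^2$, $\beta_{\mathsf{TSPD}}$ is the constant such that $\mathsf{TSPD}(\{X_1,\ldots,X_n\})/\sqrt n\to\beta_{\mathsf{TSPD}}$ almost surely and in expectation as $n\to\infty$ (this limit is known to exist). *)

theory Defs
  imports "HOL-Probability.Probability"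
begin

(* A ring is oriented from its start node to its end node, in the direction in which the cyclic
   tour traverses it.  Orientation does not affect the cost of a ring, and it keeps the two rings
   of a tour with exactly two combined nodes apart even if neither has further nodes. *)
datatype tspd_ring =
  Ring (ring_start: "real^2") (ring_end: "real^2")
       (truck_nodes: "(real^2) set") (drone_node: "(real^2) option")

definition ring_nodes :: "tspd_ring \<Rightarrow> (real^2) set" where
  "ring_nodes r = {ring_start r, ring_end r} \<union> truck_nodes r \<union> set_option (drone_node r)"

definition valid_ring :: "tspd_ring \<Rightarrow> bool" where
  "valid_ring r \<longleftrightarrow>
     ring_start r \<noteq> ring_end r \<and>
     finite (truck_nodes r) \<and>
     {ring_start r, ring_end r} \<inter> truck_nodes r = {} \<and>
     {ring_start r, ring_end r} \<inter> set_option (drone_node r) = {} \<and>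
     truck_nodes r \<inter> set_option (drone_node r) = {}"

fun path_length :: "(real^2 \<Rightarrow> real) \<Rightarrow> (real^2) list \<Rightarrow> real" where
  "path_length N (x # y # zs) = N (x - y) + path_length N (y # zs)"
| "path_length N _ = 0"

definition truck_paths :: "tspd_ring \<Rightarrow> (real^2) list set" where
  "truck_paths r =
     {ring_start r # ps @ [ring_end r] | ps. distinct ps \<and> set ps = truck_nodes r}"

(* Below, NT and ND are the truck norm and the drone norm. *)

definition ring_cost :: "(real^2 \<Rightarrow> real) \<Rightarrow> (real^2 \<Rightarrow> real) \<Rightarrow> tspd_ring \<Rightarrow> real" where
  "ring_cost NT ND r =
     Min ((\<lambda>p. case drone_node r of
                  None \<Rightarrow> path_length NT p
                | Some d \<Rightarrow> max (path_length NT p)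
                                (path_length ND [ring_start r, d, ring_end r]))
          ` truck_paths r)"

definition cyclic_tour :: "tspd_ring set \<Rightarrow> bool" where
  "cyclic_tour R \<longleftrightarrow>
     (\<exists>rs. distinct rs \<and> set rs = R \<and>
           (\<forall>i<length rs. ring_end (rs ! i) = ring_start (rs ! (Suc i mod length rs))))"

definition combined_nodes :: "tspd_ring set \<Rightarrow> (real^2) set" where
  "combined_nodes R = ring_start ` R \<union> ring_end ` R"

definition feasible :: "(real^2) set \<Rightarrow> tspd_ring set \<Rightarrow> bool" where
  "feasible X R \<longleftrightarrow>
     (\<forall>r\<in>R. valid_ring r) \<and>
     (\<Union>r\<in>R. ring_nodes r) = X \<and>
     cyclic_tour R \<and>
     (\<forall>p\<in>X. card {r \<in> R. p \<in> ring_nodes r} = (if p \<in> combined_nodes R then 2 else 1))"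

(* The convention for two-point sets is an instance of the general formula, see tspd_pair. *)
definition tspd :: "(real^2 \<Rightarrow> real) \<Rightarrow> (real^2 \<Rightarrow> real) \<Rightarrow> (real^2) set \<Rightarrow> real" where
  "tspd NT ND X =
     (if card X \<le> 1 then 0 else Min {\<Sum>r\<in>R. ring_cost NT ND r | R. feasible X R})"

definition l1_norm :: "real^2 \<Rightarrow> real" where
  "l1_norm p = (\<Sum>i\<in>UNIV. \<bar>p $ i\<bar>)"

definition rect_eucl_tspd :: "real \<Rightarrow> (real^2) set \<Rightarrow> real" where
  "rect_eucl_tspd \<alpha> X = tspd l1_norm (\<lambda>p. norm p / \<alpha>) X"


(* The minima above range over finite nonempty sets. *)

lemma finite_truck_paths:
  assumes "valid_ring r"
  shows "finite (truck_paths r)"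
proof -
  have "finite {ps. distinct ps \<and> set ps = truck_nodes r}"
    using assms finite_subset_distinct[of "truck_nodes r"]
    by (auto simp: valid_ring_def elim: finite_subset[rotated])
  moreover have "truck_paths r =
      (\<lambda>ps. ring_start r # ps @ [ring_end r]) ` {ps. distinct ps \<and> set ps = truck_nodes r}"
    by (auto simp: truck_paths_def)
  ultimately show ?thesis by simp
qed

lemma truck_paths_nonempty:
  assumes "valid_ring r"
  shows "truck_paths r \<noteq> {}"
  using assms finite_distinct_list[of "truck_nodes r"]
  by (auto simp: truck_paths_def valid_ring_def)

lemma finite_feasible:
  assumes "finite X"
  shows "finite {R. feasible X R}"
proof -
  let ?C = "(\<lambda>(a, b, T, d). Ring a b T d) `
              (X \<times> X \<times> Pow X \<times> insert None (Some ` X))"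
  have "finite ?C" using assms by simp
  have "R \<subseteq> ?C" if "feasible X R" for R
  proof
    fix r assume "r \<in> R"
    then have "ring_nodes r \<subseteq> X" using that by (auto simp: feasible_def)
    then show "r \<in> ?C"
      by (cases r; cases "drone_node r") (auto simp: ring_nodes_def image_iff)
  qed
  then have "{R. feasible X R} \<subseteq> Pow ?C" by blast
  with \<open>finite ?C\<close> show ?thesis
    by (meson finite_Pow_iff finite_subset)
qed

lemma feasible_exists:
  assumes "finite X" "card X \<ge> 2"
  shows "\<exists>R. feasible X R"
proof -
  obtain xs where xs: "set xs = X" "distinct xs"
    using finite_distinct_list[OF assms(1)] by blast
  define n where "n = length xs"
  have n: "n \<ge> 2" using assms xs distinct_card[of xs] by (simp add: n_def)
  define s where "s = (\<lambda>i. Suc i mod n)"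
  define g where "g = (\<lambda>i. Ring (xs ! i) (xs ! s i) {} None)"
  have s_lt: "s i < n" for i using n by (simp add: s_def)
  have s_neq: "s i \<noteq> i" if "i < n" for i
    using that n by (auto simp: s_def mod_Suc)
  have nth_inj: "xs ! i = xs ! j \<longleftrightarrow> i = j" if "i < n" "j < n" for i j
    using that xs by (simp add: nth_eq_iff_index_eq n_def)
  have inj: "inj_on g {..<n}"
    by (auto simp: inj_on_def g_def nth_inj)
  define R where "R = g ` {..<n}"
  have nodes: "ring_nodes (g i) = {xs ! i, xs ! s i}" for i
    by (simp add: ring_nodes_def g_def)
  have "\<forall>r\<in>R. valid_ring r"
    using nth_inj s_lt s_neq by (force simp: R_def g_def valid_ring_def)
  moreover have Un: "(\<Union>r\<in>R. ring_nodes r) = X"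
  proof -
    have "X = (\<lambda>i. xs ! i) ` {..<n}"
      using xs by (auto simp: n_def set_conv_nth)
    then show ?thesis using s_lt by (auto simp: R_def nodes)
  qed
  moreover have "cyclic_tour R"
  proof -
    let ?rs = "map g [0..<n]"
    have "distinct ?rs" using inj by (simp add: distinct_map atLeast0LessThan)
    moreover have "set ?rs = R" by (auto simp: R_def)
    moreover have "\<forall>i<length ?rs. ring_end (?rs ! i) = ring_start (?rs ! (Suc i mod length ?rs))"
      using n by (simp add: g_def s_def)
    ultimately show ?thesis unfolding cyclic_tour_def by blast
  qed
  moreover have "card {r \<in> R. p \<in> ring_nodes r} = 2 \<and> p \<in> combined_nodes R" if p: "p \<in> X" for p
  proof -
    obtain j where j: "j < n" "p = xs ! j"
      using p xs by (auto simp: n_def in_set_conv_nth)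
    define k where "k = (if j = 0 then n - 1 else j - 1)"
    have k: "k < n" "s k = j" using j n by (auto simp: k_def s_def)
    have uniq: "i = k" if "i < n" "s i = j" for i
      using that j n by (auto simp: k_def s_def mod_Suc split: if_splits)
    have "{r \<in> R. p \<in> ring_nodes r} = g ` {j, k}"
    proof -
      have "p \<in> ring_nodes (g i) \<longleftrightarrow> i \<in> {j, k}" if "i < n" for i
      proof -
        have "p \<in> ring_nodes (g i) \<longleftrightarrow> j = i \<or> j = s i"
          using nth_inj[OF j(1) that] nth_inj[OF j(1) s_lt] by (simp add: nodes j(2))
        then show ?thesis using k(2) uniq[OF that] by blast
      qed
      then show ?thesis using j(1) k(1) unfolding R_def by blast
    qed
    moreover have "j \<noteq> k" using s_neq[of k] k by auto
    ultimately have "card {r \<in> R. p \<in> ring_nodes r} = 2"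
      using inj j k by (simp add: card_image inj_on_eq_iff)
    moreover have "p \<in> combined_nodes R"
      using j by (auto simp: combined_nodes_def R_def g_def image_image)
    ultimately show ?thesis by blast
  qed
  ultimately have "feasible X R" by (simp add: feasible_def)
  then show ?thesis by blast
qed

lemma tspd_pair:
  assumes "x \<noteq> y" and sym: "\<And>p. NT (- p) = NT p"
  shows "tspd NT ND {x, y} = 2 * NT (x - y)"
proof -
  let ?a = "Ring x y {} None" and ?b = "Ring y x {} None"
  have R: "R = {?a, ?b}" if f: "feasible {x, y} R" for R
  proof -
    have "r = ?a \<or> r = ?b" if "r \<in> R" for r
    proof -
      have "valid_ring r" "ring_nodes r \<subseteq> {x, y}"
        using f that by (auto simp: feasible_def)
      then show ?thesis
        by (cases r; cases "drone_node r") (auto simp: valid_ring_def ring_nodes_def)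
    qed
    then have sub: "R \<subseteq> {?a, ?b}" by blast
    then have eq: "{r \<in> R. x \<in> ring_nodes r} = R" by (auto simp: ring_nodes_def)
    have "x \<in> (\<Union>r\<in>R. ring_nodes r)" using f by (simp add: feasible_def)
    then have "x \<in> combined_nodes R"
      using sub by (auto simp: combined_nodes_def ring_nodes_def)
    then have "card R = 2" using f eq by (simp add: feasible_def)
    then show ?thesis using sub assms(1) by (intro card_subset_eq) auto
  qed
  have "card {x, y} = 2" using assms(1) by simp
  then have "feasible {x, y} {?a, ?b}"
    using feasible_exists[of "{x, y}"] R by auto
  then have "{\<Sum>r\<in>R. ring_cost NT ND r | R. feasible {x, y} R} =
      {\<Sum>r\<in>{?a, ?b}. ring_cost NT ND r}"
    using R by blast
  moreover have "ring_cost NT ND (Ring u v {} None) = NT (u - v)" for u v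
    by (simp add: ring_cost_def truck_paths_def)
  moreover have "NT (y - x) = NT (x - y)" using sym[of "x - y"] by simp
  ultimately show ?thesis using assms(1) by (simp add: tspd_def)
qed

end

theory Submission
  imports Defs "HOL-Real_Asymp.Real_Asymp"
begin

text \<open>
  The truck closes a cycle through all combined and truck nodes, of length at most the makespan $Z$.

  For the first bound, every node is joined to two distinct other nodes: the truck and combined nodes
  by the edges of the truck cycle, the drone nodes by the legs of their drone.  Counting each truck
  edge at both ends and each drone leg once, the sum over all nodes of the distances to the two nearest
  neighbours is at most $2Z + \alpha Z$.  For $n$ uniform points this sum is asymptotically at least
  $(\frac12 + \frac34)\sqrt n$, as boundary effects only increase distances.

  For the second bound, each ring has at most one drone node, so the truck visits at least half of the
  nodes.  A path through $k + 1$ prescribed uniform points has $\ell_1$-length at most $a$ with probability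
  at most $(ea/k)^{2k}$ (Chernoff), and there are at most $n^{k+1}$ such paths; with $k \approx n/2$ the
  union bound tends to $0$ for $a = c\sqrt n$ and $c < \frac{1}{2e}$.
\<close>

section \<open>The truck cycle\<close>

text \<open>What is compared with \<open>\<beta>\<close> is an almost sure limit, while both
  estimates control means. The makespan is therefore only compared pointwise with explicit
  measurable functions of the sample, and these alone are integrated: uniformly bounded ones for the
  first bound, where dominated convergence applies, and nonnegative ones for the second, where
  Fatou's lemma applies. Origin of 1/2 and 3/4: after rescaling, the sample around a typical point
  resembles a Poisson process of intensity 1. Its first and second nearest neighbour are farther
  than r with probability exp(-pi r^2) and (1 + pi r^2) exp(-pi r^2), and these integrate over r to
  1/2 and 3/4. Origin of the Chernoff bound: the integral of exp(-\<theta> |y|_1) over the plane is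
  4/\<theta>^2, so k edges contribute (4/\<theta>^2)^k. The choice \<theta> = 2k/a minimises
  exp(\<theta> a) (4/\<theta>^2)^k, with value (ea/k)^(2k). For a = c sqrt n and k close to n/2 the
  union bound is of order n (2ec)^n.\<close>

lemma path_length_append:
  "path_length N (xs @ a # ys) = path_length N (xs @ [a]) + path_length N (a # ys)"
proof (induction xs)
  case (Cons x xs)
  then show ?case by (cases xs) auto
qed simp

lemma path_length_nonneg: "(\<And>p. N p \<ge> 0) \<Longrightarrow> path_length N xs \<ge> 0"
  by (induction N xs rule: path_length.induct) (auto intro: add_nonneg_nonneg)

lemma path_length_mono: "(\<And>p. N p \<le> N' p) \<Longrightarrow> path_length N xs \<le> path_length N' xs"
  by (induction N xs rule: path_length.induct) (auto intro: add_mono)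

lemma path_length_append_ge:
  assumes "\<And>p. N p \<ge> 0"
  shows "path_length N xs \<le> path_length N (xs @ ys)"
proof (induction xs)
  case Nil
  then show ?case using assms by (simp add: path_length_nonneg)
next
  case (Cons x xs)
  then show ?case using path_length_nonneg[of N, OF assms] by (cases xs) auto
qed

text \<open>Each block omits its end node, which reappears as the start node of the next block; only
  the last end node has to be appended.\<close>

lemma path_length_concat:
  assumes "rs \<noteq> []" "\<And>i. Suc i < length rs \<Longrightarrow> ring_end (rs ! i) = ring_start (rs ! Suc i)"
  shows "path_length N (concat (map (\<lambda>r. ring_start r # ps r) rs) @ [ring_end (last rs)])
    = (\<Sum>r\<leftarrow>rs. path_length N (ring_start r # ps r @ [ring_end r]))"
  using assms
proof (induction rs)
  case (Cons r rs)
  show ?case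
  proof (cases rs)
    case (Cons r' rs')
    define zs where "zs = ps r' @ concat (map (\<lambda>r. ring_start r # ps r) rs') @ [ring_end (last rs)]"
    have e: "ring_end r = ring_start r'"
      using Cons.prems(2)[of 0] Cons by simp
    have IH: "path_length N (concat (map (\<lambda>r. ring_start r # ps r) rs) @ [ring_end (last rs)])
      = (\<Sum>r\<leftarrow>rs. path_length N (ring_start r # ps r @ [ring_end r]))"
    proof (rule Cons.IH)
      show "ring_end (rs ! i) = ring_start (rs ! Suc i)" if "Suc i < length rs" for i
        using Cons.prems(2)[of "Suc i"] that by simp
    qed (simp add: Cons)
    have "concat (map (\<lambda>r. ring_start r # ps r) (r # rs)) @ [ring_end (last (r # rs))]
        = (ring_start r # ps r) @ ring_start r' # zs"
      by (simp add: zs_def Cons)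
    moreover have "concat (map (\<lambda>r. ring_start r # ps r) rs) @ [ring_end (last rs)] = ring_start r' # zs"
      by (simp add: zs_def Cons)
    ultimately show ?thesis
      using IH path_length_append[of N "ring_start r # ps r" "ring_start r'" zs] e
      by (simp only: list.map sum_list.Cons append_Cons)
  qed simp
qed simp

lemma path_length_conv_sum:
  "path_length N xs = (\<Sum>i<length xs - 1. N (xs ! i - xs ! Suc i))"
proof (induction N xs rule: path_length.induct)
  case (1 N x y zs)
  then show ?case by (simp add: sum.lessThan_Suc_shift del: sum.lessThan_Suc)
qed auto

lemma path_length_cycle_conv_sum:
  assumes "xs \<noteq> []"
  shows "path_length N (xs @ [hd xs]) =
    (\<Sum>i<length xs. N (xs ! i - xs ! (Suc i mod length xs)))"
proof -
  have "(xs @ [hd xs]) ! i - (xs @ [hd xs]) ! Suc i = xs ! i - xs ! (Suc i mod length xs)"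
    if "i < length xs" for i
    using that assms by (cases "Suc i = length xs") (auto simp: nth_append hd_conv_nth)
  then show ?thesis by (simp add: path_length_conv_sum)
qed

lemma bij_betw_Suc_mod:
  assumes "n > 0"
  shows "bij_betw (\<lambda>i. Suc i mod n) {..<n} {..<n}"
proof -
  have "inj_on (\<lambda>i. Suc i mod n) {..<n}"
    by (auto simp: inj_on_def mod_Suc split: if_splits)
  moreover have "(\<lambda>i. Suc i mod n) ` {..<n} \<subseteq> {..<n}" using assms by auto
  ultimately show ?thesis by (simp add: bij_betw_def endo_inj_surj)
qed

text \<open>Three nodes are the least number for which predecessor and successor on the cycle are
  always distinct, so that both can serve as \<open>a\<close> and \<open>b\<close>.\<close>

lemma sum_neighbour_bound_le_cycle:
  assumes "distinct xs" "length xs \<ge> 3" and sym: "\<And>p. N (- p) = N p"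
    and h: "\<And>p a b. {p, a, b} \<subseteq> set xs \<Longrightarrow> a \<noteq> b \<Longrightarrow> a \<noteq> p \<Longrightarrow> b \<noteq> p
      \<Longrightarrow> h p \<le> N (p - a) + N (p - b)"
  shows "(\<Sum>p\<in>set xs. h p) \<le> 2 * path_length N (xs @ [hd xs])"
proof -
  define n where "n = length xs"
  define s where "s = (\<lambda>i. Suc i mod n)"
  have n: "n \<ge> 3" using assms by (simp add: n_def)
  have s: "s i < n" for i using n by (simp add: s_def)
  have bij: "bij_betw s {..<n} {..<n}" unfolding s_def using n by (intro bij_betw_Suc_mod) simp
  have ne: "s i \<noteq> i" "s (s i) \<noteq> i" "s (s i) \<noteq> s i" if "i < n" for i
    using that n by (auto simp: s_def mod_Suc)
  have "bij_betw ((!) xs) {..<n} (set xs)"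
    using assms(1) by (intro bij_betw_nth) (auto simp: n_def)
  then have "(\<Sum>p\<in>set xs. h p) = (\<Sum>i<n. h (xs ! i))"
    by (simp add: sum.reindex_bij_betw)
  \<comment> \<open>Re-indexing by the predecessor: the neighbours of node \<open>s i\<close> are
    \<open>i\<close> and \<open>s (s i)\<close>, which avoids subtraction modulo
    \<open>n\<close>.\<close>
  also have "\<dots> = (\<Sum>i<n. h (xs ! s i))"
    using sum.reindex_bij_betw[OF bij, of "\<lambda>i. h (xs ! i)"] by simp
  also have "\<dots> \<le> (\<Sum>i<n. N (xs ! i - xs ! s i) + N (xs ! s i - xs ! s (s i)))"
  proof (rule sum_mono)
    fix i assume "i \<in> {..<n}"
    then have i: "i < n" by simp
    have "h (xs ! s i) \<le> N (xs ! s i - xs ! i) + N (xs ! s i - xs ! s (s i))"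
      using i s ne[OF i] assms(1) by (intro h) (auto simp: n_def nth_eq_iff_index_eq)
    then show "h (xs ! s i) \<le> N (xs ! i - xs ! s i) + N (xs ! s i - xs ! s (s i))"
      using sym[of "xs ! s i - xs ! i"] by simp
  qed
  also have "\<dots> = 2 * (\<Sum>i<n. N (xs ! i - xs ! s i))"
    using sum.reindex_bij_betw[OF bij, of "\<lambda>i. N (xs ! i - xs ! s i)"]
    by (simp add: sum.distrib)
  also have "\<dots> = 2 * path_length N (xs @ [hd xs])"
    using n path_length_cycle_conv_sum[of xs N] unfolding n_def s_def by fastforce
  finally show ?thesis .
qed

section \<open>From a feasible solution to a single truck cycle\<close>

lemma ring_cost_witness:
  assumes "valid_ring r"
  obtains ps where "distinct ps" "set ps = truck_nodes r"
    "path_length NT (ring_start r # ps @ [ring_end r]) \<le> ring_cost NT ND r"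
    "\<And>d. drone_node r = Some d \<Longrightarrow> ND (ring_start r - d) + ND (d - ring_end r) \<le> ring_cost NT ND r"
proof -
  define c where "c = (\<lambda>p. case drone_node r of None \<Rightarrow> path_length NT p
    | Some d \<Rightarrow> max (path_length NT p) (path_length ND [ring_start r, d, ring_end r]))"
  have "ring_cost NT ND r = Min (c ` truck_paths r)"
    by (simp add: ring_cost_def c_def)
  then have "ring_cost NT ND r \<in> c ` truck_paths r"
    using finite_truck_paths[OF assms] truck_paths_nonempty[OF assms] by simp
  then obtain ps where "distinct ps" "set ps = truck_nodes r"
    "ring_cost NT ND r = c (ring_start r # ps @ [ring_end r])"
    by (auto simp: truck_paths_def)
  then show thesis
    by (intro that[of ps]) (auto simp: c_def split: option.splits)
qed

lemma tspd_witness: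
  assumes "finite P" "card P \<ge> 2"
  obtains R where "feasible P R" "tspd NT ND P = (\<Sum>r\<in>R. ring_cost NT ND r)"
proof -
  let ?S = "{\<Sum>r\<in>R. ring_cost NT ND r | R. feasible P R}"
  have eq: "?S = (\<lambda>R. \<Sum>r\<in>R. ring_cost NT ND r) ` {R. feasible P R}" by auto
  have "Min ?S \<in> ?S"
    using finite_feasible[OF assms(1)] feasible_exists[OF assms] by (intro Min_in) (auto simp: eq)
  then show thesis using that assms by (auto simp: tspd_def)
qed

definition drone_nodes :: "tspd_ring set \<Rightarrow> (real^2) set" where
  "drone_nodes R = {d. \<exists>r\<in>R. drone_node r = Some d}"

lemma feasible_rings_through:
  assumes "feasible P R" "r \<in> R" "r' \<in> R" "r'' \<in> R"
    "p \<in> ring_nodes r" "p \<in> ring_nodes r'" "p \<in> ring_nodes r''"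
  shows "r = r' \<or> r = r'' \<or> r' = r''"
proof (rule ccontr)
  assume *: "\<not> ?thesis"
  have "finite R" using assms(1) by (auto simp: feasible_def cyclic_tour_def)
  then have "card {r, r', r''} \<le> card {r \<in> R. p \<in> ring_nodes r}"
    using assms by (intro card_mono) auto
  moreover have "card {r, r', r''} = 3" using * by simp
  moreover have "p \<in> P" using assms by (auto simp: feasible_def)
  then have "card {r \<in> R. p \<in> ring_nodes r} \<le> 2" using assms(1) by (auto simp: feasible_def)
  ultimately show False by simp
qed

text \<open>By validity, neither \<open>r\<close> nor \<open>r'\<close> ends at a shared node
  \<open>p\<close>. But some ring does end at \<open>p\<close>, and it would be a third ring through
  \<open>p\<close>, which the multiplicity condition excludes.\<close>

lemma feasible_truck_disjoint:
  assumes f: "feasible P R" and r: "r \<in> R" "r' \<in> R" "r \<noteq> r'"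
    and pre: "\<And>r. r \<in> R \<Longrightarrow> \<exists>q\<in>R. ring_end q = ring_start r"
  shows "insert (ring_start r) (truck_nodes r) \<inter> insert (ring_start r') (truck_nodes r') = {}"
proof (rule ccontr)
  assume "\<not> ?thesis"
  then obtain p where p: "p \<in> insert (ring_start r) (truck_nodes r)"
    "p \<in> insert (ring_start r') (truck_nodes r')" by blast
  have v: "valid_ring q" if "q \<in> R" for q using f that by (simp add: feasible_def)
  have in_r: "p \<in> ring_nodes r" "p \<in> ring_nodes r'" using p by (auto simp: ring_nodes_def)
  have *: "q = r \<or> q = r'" if "q \<in> R" "p \<in> ring_nodes q" for q
    using feasible_rings_through[OF f r(1,2) that(1) in_r that(2)] r(3) by blast
  show False
  proof (cases "p \<in> ring_start ` R")
    case True
    then obtain q where "q \<in> R" "ring_end q = p" using pre by auto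
    moreover have "p \<in> ring_nodes q" using calculation by (auto simp: ring_nodes_def)
    ultimately show False using *[of q] p v[OF r(1)] v[OF r(2)] by (auto simp: valid_ring_def)
  next
    case False
    then have "p \<in> truck_nodes r" "p \<in> truck_nodes r'" using p r by auto
    \<comment> \<open>Lying in two rings already forces \<open>p\<close> to be combined; as it
      starts no ring, it must end one.\<close>
    moreover have "p \<in> combined_nodes R"
    proof (rule ccontr)
      assume "p \<notin> combined_nodes R"
      moreover have "p \<in> P" using f r in_r by (auto simp: feasible_def)
      ultimately have "card {r \<in> R. p \<in> ring_nodes r} = 1" using f by (auto simp: feasible_def)
      then obtain z where z: "{r \<in> R. p \<in> ring_nodes r} = {z}" by (auto simp: card_1_singleton_iff)
      have "r \<in> {z}" "r' \<in> {z}" unfolding z[symmetric] using r in_r by auto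
      then show False using r by simp
    qed
    then obtain q where "q \<in> R" "ring_end q = p" using False by (auto simp: combined_nodes_def)
    moreover have "p \<in> ring_nodes q" using calculation by (auto simp: ring_nodes_def)
    ultimately show False using *[of q] v[OF r(1)] v[OF r(2)] by (auto simp: valid_ring_def)
  qed
qed

text \<open>Every ring contributes at least its start node to \<open>C\<close> and at most one drone
  node to the rest. The bound on \<open>card R\<close> records this, so that the drone nodes can
  later be counted against \<open>C\<close>.\<close>

lemma truck_tour:
  assumes f: "feasible P R" and "P \<noteq> {}"
  obtains C where "distinct C" "C \<noteq> []" "set C \<subseteq> P" "P \<subseteq> set C \<union> drone_nodes R"
    "card R \<le> length C" "path_length NT (C @ [hd C]) \<le> (\<Sum>r\<in>R. ring_cost NT ND r)"
proof -
  have v: "valid_ring r" if "r \<in> R" for r using f that by (simp add: feasible_def)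
  have Un: "(\<Union>r\<in>R. ring_nodes r) = P" using f by (simp add: feasible_def)
  obtain rs where rs: "distinct rs" "set rs = R"
    "\<And>i. i < length rs \<Longrightarrow> ring_end (rs ! i) = ring_start (rs ! (Suc i mod length rs))"
    using f by (auto simp: feasible_def cyclic_tour_def)
  have "R \<noteq> {}" using Un assms(2) by auto
  then have ne: "rs \<noteq> []" using rs by auto
  have suc: "\<exists>q\<in>R. ring_start q = ring_end r" if r: "r \<in> R" for r
  proof -
    obtain i where "i < length rs" "r = rs ! i" using r rs(2) by (auto simp: in_set_conv_nth)
    then show ?thesis using rs ne by (metis length_greater_0_conv mod_less_divisor nth_mem)
  qed
  have pre: "\<exists>q\<in>R. ring_end q = ring_start r" if r: "r \<in> R" for r
  proof -
    obtain i where i: "i < length rs" "r = rs ! i" using r rs(2) by (auto simp: in_set_conv_nth)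
    have "(\<lambda>i. Suc i mod length rs) ` {..<length rs} = {..<length rs}"
      using bij_betw_Suc_mod[of "length rs"] ne by (simp add: bij_betw_def)
    then obtain j where "j < length rs" "i = Suc j mod length rs" using i by blast
    then show ?thesis using rs i by (metis nth_mem)
  qed
  define ok where "ok = (\<lambda>r ps. distinct ps \<and> set ps = truck_nodes r \<and>
    path_length NT (ring_start r # ps @ [ring_end r]) \<le> ring_cost NT ND r)"
  have "\<forall>r\<in>R. \<exists>ps. ok r ps" using v unfolding ok_def by (metis ring_cost_witness)
  then obtain ps where ps: "\<And>r. r \<in> R \<Longrightarrow> ok r (ps r)" by metis
  define g where "g = (\<lambda>r. ring_start r # ps r)"
  define C where "C = concat (map g rs)"
  have setg: "set (g r) = insert (ring_start r) (truck_nodes r)" if "r \<in> R" for r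
    using ps[OF that] by (simp add: g_def ok_def)
  have disj: "set (g r) \<inter> set (g r') = {}" if "r \<in> R" "r' \<in> R" "r \<noteq> r'" for r r'
    using feasible_truck_disjoint[OF f that pre] that setg by simp
  have "distinct C" unfolding C_def
  proof (rule distinct_concat)
    have "inj_on g R"
    proof (rule inj_onI, rule ccontr)
      fix r r' assume "r \<in> R" "r' \<in> R" "g r = g r'" "r \<noteq> r'"
      then show False using disj[of r r'] by (auto simp: g_def)
    qed
    then show "distinct (map g rs)" using rs by (simp add: distinct_map)
    show "distinct ys" if "ys \<in> set (map g rs)" for ys
      using that ps v rs by (auto simp: g_def ok_def valid_ring_def)
    show "set ys \<inter> set zs = {}"
      if "ys \<in> set (map g rs)" "zs \<in> set (map g rs)" "ys \<noteq> zs" for ys zs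
      using that disj rs by auto
  qed
  moreover have setC: "set C = (\<Union>r\<in>R. insert (ring_start r) (truck_nodes r))"
    using rs setg by (simp add: C_def)
  moreover have "set C \<subseteq> P" unfolding setC Un[symmetric] by (auto simp: ring_nodes_def)
  moreover have "P \<subseteq> set C \<union> drone_nodes R"
  proof
    fix p assume "p \<in> P"
    then obtain r where r: "r \<in> R" "p \<in> ring_nodes r" using Un by blast
    obtain q where q: "q \<in> R" "ring_start q = ring_end r" using suc[OF r(1)] by blast
    consider "p = ring_start r \<or> p \<in> truck_nodes r" | "p = ring_start q" | "drone_node r = Some p"
      using r(2) q(2) by (auto simp: ring_nodes_def)
    then show "p \<in> set C \<union> drone_nodes R"
      using r(1) q(1) unfolding setC drone_nodes_def by cases blast+
  qed
  moreover have Cne: "C \<noteq> []" using ne by (cases rs) (auto simp: C_def g_def)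
  moreover have "length rs \<le> length C" unfolding C_def
    by (induction rs) (auto simp: g_def)
  then have "card R \<le> length C" using rs distinct_card by fastforce
  moreover have "path_length NT (C @ [hd C]) \<le> (\<Sum>r\<in>R. ring_cost NT ND r)"
  proof -
    \<comment> \<open>At the last index the cyclic condition wraps around, so the final end node of
      the concatenation is \<open>hd C\<close> and the path is the closed cycle.\<close>
    have "Suc (length rs - 1) = length rs" using ne by simp
    then have "ring_end (last rs) = ring_start (hd rs)"
      using rs(3)[of "length rs - 1"] ne by (simp add: last_conv_nth hd_conv_nth)
    moreover have "hd C = ring_start (hd rs)" using ne by (cases rs) (auto simp: C_def g_def)
    ultimately have "hd C = ring_end (last rs)" by simp
    then have "path_length NT (C @ [hd C])
      = (\<Sum>r\<leftarrow>rs. path_length NT (ring_start r # ps r @ [ring_end r]))"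
      using ne rs(3) path_length_concat[of rs NT ps] by (simp add: C_def g_def)
    also have "\<dots> = (\<Sum>r\<in>R. path_length NT (ring_start r # ps r @ [ring_end r]))"
      using rs by (simp add: sum_list_distinct_conv_sum_set)
    also have "\<dots> \<le> (\<Sum>r\<in>R. ring_cost NT ND r)"
      using ps by (intro sum_mono) (auto simp: ok_def)
    finally show ?thesis .
  qed
  ultimately show thesis using that by blast
qed

lemma card_drone_nodes_le:
  assumes "finite R"
  shows "finite (drone_nodes R)" "card (drone_nodes R) \<le> card R"
proof -
  have "drone_nodes R \<subseteq> (the \<circ> drone_node) ` R" by (force simp: drone_nodes_def image_iff)
  then show "finite (drone_nodes R)" "card (drone_nodes R) \<le> card R"
    using assms by (auto intro: finite_subset surj_card_le)
qed

text \<open>Form used for counting paths: the closing edge is dropped, because the probability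
  estimate is for open paths through distinct points.\<close>

lemma tspd_truck_tour:
  assumes "finite P" "card P \<ge> 2" "\<And>p. NT p \<ge> 0"
  obtains C where "distinct C" "set C \<subseteq> P" "card P \<le> 2 * length C"
    "path_length NT C \<le> tspd NT ND P"
proof -
  obtain R where R: "feasible P R" "tspd NT ND P = (\<Sum>r\<in>R. ring_cost NT ND r)"
    using tspd_witness[OF assms(1,2)] by blast
  have fin: "finite R" using R by (auto simp: feasible_def cyclic_tour_def)
  have "P \<noteq> {}" using assms by auto
  then obtain C where C: "distinct C" "set C \<subseteq> P" "P \<subseteq> set C \<union> drone_nodes R"
    "card R \<le> length C" "path_length NT (C @ [hd C]) \<le> (\<Sum>r\<in>R. ring_cost NT ND r)"
    using truck_tour[OF R(1), of NT ND thesis] by blast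
  have "card P \<le> card (set C) + card (drone_nodes R)"
    using order_trans[OF card_mono[OF _ C(3)] card_Un_le] card_drone_nodes_le[OF fin] by simp
  then have "card P \<le> 2 * length C"
    using C card_drone_nodes_le[OF fin] distinct_card[OF C(1)] by simp
  moreover have "path_length NT C \<le> tspd NT ND P"
    using C(5) R(2) path_length_append_ge[of NT C "[hd C]"] assms(3) by simp
  ultimately show thesis using that C by blast
qed

text \<open>The function \<open>h\<close> stands for the sum of the distances to the two nearest
  neighbours. It is kept abstract so that a bounded truncation can take its place. Drone legs enter
  with factor \<open>\<alpha>\<close>, since their Euclidean length is \<open>\<alpha>\<close> times
  their cost.\<close>

lemma sum_neighbour_bound_le_tspd:
  assumes "finite P" "card P \<ge> 5" "\<alpha> > 0"
    and NT: "\<And>p. norm p \<le> NT p" and h0: "\<And>p. h p \<ge> 0"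
    and h: "\<And>p a b. {p, a, b} \<subseteq> P \<Longrightarrow> a \<noteq> b \<Longrightarrow> a \<noteq> p \<Longrightarrow> b \<noteq> p
      \<Longrightarrow> h p \<le> norm (p - a) + norm (p - b)"
  shows "(\<Sum>p\<in>P. h p) \<le> (\<alpha> + 2) * tspd NT (\<lambda>p. norm p / \<alpha>) P"
proof -
  define ND where "ND = (\<lambda>p::real^2. norm p / \<alpha>)"
  obtain R where R: "feasible P R" "tspd NT ND P = (\<Sum>r\<in>R. ring_cost NT ND r)"
    using tspd_witness[of P NT ND] assms(1,2) by auto
  have fin: "finite R" using R by (auto simp: feasible_def cyclic_tour_def)
  have v: "valid_ring r" "ring_nodes r \<subseteq> P" if "r \<in> R" for r
    using R that by (auto simp: feasible_def)
  have "P \<noteq> {}" using assms by auto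
  then obtain C where C: "distinct C" "set C \<subseteq> P" "P \<subseteq> set C \<union> drone_nodes R"
    "card R \<le> length C" "path_length NT (C @ [hd C]) \<le> (\<Sum>r\<in>R. ring_cost NT ND r)"
    using truck_tour[OF R(1), of NT ND thesis] by blast
  have finD: "finite (drone_nodes R)" using card_drone_nodes_le[OF fin] by blast
  have "card P \<le> card (set C) + card (drone_nodes R)"
    using order_trans[OF card_mono[OF _ C(3)] card_Un_le] finD by simp
  then have "card P \<le> 2 * length C"
    using C card_drone_nodes_le[OF fin] distinct_card[OF C(1)] by simp
  \<comment> \<open>This is the origin of the bound 5: half of five nodes, rounded up, is
    three.\<close>
  then have "length C \<ge> 3" using assms(2) by simp
  \<comment> \<open>A possible overlap of the two sets does no harm, because \<open>h\<close> is
    nonnegative.\<close>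
  have "(\<Sum>p\<in>P. h p) \<le> (\<Sum>p\<in>set C \<union> drone_nodes R. h p)"
    using C(3) finD h0 by (intro sum_mono2) auto
  also have "\<dots> \<le> (\<Sum>p\<in>set C. h p) + (\<Sum>p\<in>drone_nodes R. h p)"
    using sum.union_inter[of "set C" "drone_nodes R" h] finD
      sum_nonneg[of "set C \<inter> drone_nodes R" h] h0 by simp
  also have "(\<Sum>p\<in>set C. h p) \<le> 2 * path_length norm (C @ [hd C])"
  proof (rule sum_neighbour_bound_le_cycle)
    show "h p \<le> norm (p - a) + norm (p - b)"
      if "{p, a, b} \<subseteq> set C" "a \<noteq> b" "a \<noteq> p" "b \<noteq> p" for p a b
      using that C(2) by (intro h) auto
  qed (use \<open>length C \<ge> 3\<close> C(1) in auto)
  also have "path_length norm (C @ [hd C]) \<le> path_length NT (C @ [hd C])"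
    by (intro path_length_mono NT)
  also have "\<dots> \<le> (\<Sum>r\<in>R. ring_cost NT ND r)" by fact
  also have "(\<Sum>p\<in>drone_nodes R. h p) \<le> (\<Sum>r\<in>R. \<alpha> * ring_cost NT ND r)"
  proof -
    define R' where "R' = {r \<in> R. drone_node r \<noteq> None}"
    have D: "drone_nodes R = (the \<circ> drone_node) ` R'"
      by (force simp: drone_nodes_def R'_def image_iff)
    have cost: "ring_cost NT ND r \<ge> 0" "\<And>d. drone_node r = Some d \<Longrightarrow> h d \<le> \<alpha> * ring_cost NT ND r"
      if r: "r \<in> R" for r
    proof -
      obtain ps where ps: "path_length NT (ring_start r # ps @ [ring_end r]) \<le> ring_cost NT ND r"
        "\<And>d. drone_node r = Some d \<Longrightarrow> ND (ring_start r - d) + ND (d - ring_end r) \<le> ring_cost NT ND r"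
        using ring_cost_witness[OF v(1)[OF r], of NT ND] by metis
      have "NT p \<ge> 0" for p using NT[of p] norm_ge_zero[of p] by linarith
      then show "ring_cost NT ND r \<ge> 0" using ps(1) path_length_nonneg[of NT] by (meson order_trans)
      fix d assume d: "drone_node r = Some d"
      have "h d \<le> norm (d - ring_start r) + norm (d - ring_end r)"
        using d v[OF r] by (intro h) (auto simp: valid_ring_def ring_nodes_def)
      also have "\<dots> = \<alpha> * (ND (ring_start r - d) + ND (d - ring_end r))"
        using assms(3) by (simp add: ND_def field_simps norm_minus_commute)
      also have "\<dots> \<le> \<alpha> * ring_cost NT ND r" using ps(2)[OF d] assms(3) by simp
      finally show "h d \<le> \<alpha> * ring_cost NT ND r" .
    qed
    have "(\<Sum>p\<in>drone_nodes R. h p) \<le> (\<Sum>r\<in>R'. h (the (drone_node r)))"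
      unfolding D using sum_image_le[of R' h "the \<circ> drone_node"] fin h0 by (simp add: R'_def o_def)
    also have "\<dots> \<le> (\<Sum>r\<in>R'. \<alpha> * ring_cost NT ND r)"
      using cost by (intro sum_mono) (auto simp: R'_def)
    also have "\<dots> \<le> (\<Sum>r\<in>R. \<alpha> * ring_cost NT ND r)"
      using fin cost assms(3) by (intro sum_mono2) (auto simp: R'_def)
    finally show ?thesis .
  qed
  finally show ?thesis
    by (simp add: R(2)[symmetric] ND_def[symmetric] sum_distrib_left[symmetric] algebra_simps)
qed

section \<open>Samples of uniform points\<close>

lemma max_zero_one_minus_sum:
  assumes "finite I" "\<And>i. i \<in> I \<Longrightarrow> b i \<in> {0, 1::real}"
  shows "max 0 (1 - (\<Sum>i\<in>I. b i)) = (\<Prod>i\<in>I. 1 - b i)"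
  using assms
proof (induction rule: finite_induct)
  case (insert i I)
  then have IH: "max 0 (1 - (\<Sum>i\<in>I. b i)) = (\<Prod>i\<in>I. 1 - b i)" by simp
  have "(\<Sum>i\<in>I. b i) \<ge> 0" using insert.prems by (intro sum_nonneg) force
  moreover have "b i = 0 \<or> b i = 1" using insert.prems by simp
  ultimately show ?case using IH insert.hyps by auto
qed simp

text \<open>The left side is 2, 1 or 0 according to whether none, one or more of the
  \<open>b i\<close> are 1; \<open>j\<close> is the position of a single 1. Products are wanted
  because their means factor under a product measure.\<close>

lemma max_zero_two_minus_sum:
  assumes "finite I" "\<And>i. i \<in> I \<Longrightarrow> b i \<in> {0, 1::real}"
  shows "max 0 (2 - (\<Sum>i\<in>I. b i))
    = 2 * (\<Prod>i\<in>I. 1 - b i) + (\<Sum>j\<in>I. \<Prod>i\<in>I. if i = j then b i else 1 - b i)"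
  using assms
proof (induction rule: finite_induct)
  case (insert k I)
  have IH: "max 0 (2 - (\<Sum>i\<in>I. b i))
    = 2 * (\<Prod>i\<in>I. 1 - b i) + (\<Sum>j\<in>I. \<Prod>i\<in>I. if i = j then b i else 1 - b i)"
    using insert by simp
  \<comment> \<open>Used when \<open>b k = 1\<close>, which lowers the 2 to 1 for the remaining
    indices.\<close>
  have one: "max 0 (1 - (\<Sum>i\<in>I. b i)) = (\<Prod>i\<in>I. 1 - b i)"
    using insert by (intro max_zero_one_minus_sum) auto
  have "(\<Prod>i\<in>I. if i = k then b i else 1 - b i) = (\<Prod>i\<in>I. 1 - b i)"
    using insert.hyps by (intro prod.cong) auto
  moreover have "(\<Sum>j\<in>I. \<Prod>i\<in>insert k I. if i = j then b i else 1 - b i)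
      = (\<Sum>j\<in>I. (1 - b k) * (\<Prod>i\<in>I. if i = j then b i else 1 - b i))"
    using insert.hyps by (intro sum.cong) auto
  moreover have "b k = 0 \<or> b k = 1" using insert.prems by simp
  ultimately show ?case
    using IH one insert.hyps by (auto simp: sum_distrib_left[symmetric])
qed simp

text \<open>The mean of $\max(0, 2 - N)$ for a binomial variable $N$ with parameters $m$ and $p$.\<close>

definition void_mean :: "nat \<Rightarrow> real \<Rightarrow> real" where
  "void_mean m p = 2 * (1 - p) ^ m + real m * p * (1 - p) ^ (m - 1)"

text \<open>Conditioning on one trial: a success leaves \<open>max 0 (1 - N)\<close>, whose mean is
  the probability \<open>(1 - p) ^ m\<close> of no further success.\<close>

lemma void_mean_Suc: "void_mean (Suc m) p = (1 - p) * void_mean m p + p * (1 - p) ^ m"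
  by (cases m) (auto simp: void_mean_def algebra_simps)

text \<open>Near the boundary of the square a disc has less than its full mass; this monotonicity
  makes the full area the worst case. In the recursion, a larger \<open>p\<close> shifts weight from
  \<open>void_mean m p\<close> to the smaller \<open>(1 - p) ^ m\<close>.\<close>

lemma void_mean_antimono:
  assumes "0 \<le> p" "p \<le> q" "q \<le> 1"
  shows "void_mean m q \<le> void_mean m p"
proof (induction m)
  case (Suc m)
  have pw: "(1 - q) ^ m \<le> (1 - p) ^ m" using assms by (intro power_mono) auto
  have ge: "(1 - p) ^ m \<le> void_mean m p"
    using assms by (simp add: void_mean_def add_increasing2)
  have "void_mean (Suc m) q \<le> (1 - q) * void_mean m p + q * (1 - p) ^ m"
    using Suc pw assms unfolding void_mean_Suc by (intro add_mono mult_left_mono) auto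
  also have "\<dots> \<le> (1 - p) * void_mean m p + p * (1 - p) ^ m"
    using mult_right_mono[OF ge, of "q - p"] assms by (simp add: algebra_simps)
  finally show ?case by (simp add: void_mean_Suc)
qed (simp add: void_mean_def)

lemma (in prob_space) PiM_integral_max_zero_two_minus:
  assumes "finite I" and A: "A \<in> events"
  shows "(\<integral>\<^sup>+x. ennreal (max 0 (2 - (\<Sum>i\<in>I. indicator A (x i)))) \<partial>PiM I (\<lambda>_. M))
    = ennreal (void_mean (card I) (prob A))"
proof -
  interpret PP: product_prob_space "\<lambda>_. M" I by standard
  define N where "N = PiM I (\<lambda>_. M)"
  have int: "integrable M (\<lambda>x. indicator A x :: real)"
    using A by (intro integrable_real_indicator) (auto simp: emeasure_eq_measure)
  then have int1: "integrable M (\<lambda>x. 1 - indicator A x :: real)"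
    by (intro Bochner_Integration.integrable_diff) auto
  have e1: "expectation (\<lambda>x. 1 - indicator A x :: real) = 1 - prob A"
    using int A by (subst Bochner_Integration.integral_diff) (auto simp: prob_space)
  have 1: "has_bochner_integral N (\<lambda>x. \<Prod>i\<in>I. 1 - indicator A (x i) :: real) ((1 - prob A) ^ card I)"
    using PP.product_integrable_prod[OF assms(1), of "\<lambda>_ x. 1 - indicator A x :: real", OF int1]
      PP.product_integral_prod[OF assms(1), of "\<lambda>_ x. 1 - indicator A x :: real", OF int1] A
    by (simp add: has_bochner_integral_iff N_def e1)
  have 2: "has_bochner_integral N
      (\<lambda>x. \<Prod>i\<in>I. if i = j then indicator A (x i) else 1 - indicator A (x i) :: real)
      (prob A * (1 - prob A) ^ (card I - 1))" if "j \<in> I" for j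
  proof -
    define f where "f = (\<lambda>i x. if i = j then indicator A x else 1 - indicator A x :: real)"
    have f: "integrable M (f i)" for i using int int1 unfolding f_def by (cases "i = j") simp_all
    have "integral\<^sup>L M (f i) = (if i = j then prob A else 1 - prob A)" for i
      using A by (simp add: f_def e1)
    then have "(\<Prod>i\<in>I. integral\<^sup>L M (f i)) = prob A * (1 - prob A) ^ (card I - 1)"
      using that assms(1) by (simp add: prod.remove[of I j])
    then show ?thesis
      using PP.product_integrable_prod[OF assms(1), of f, OF f]
        PP.product_integral_prod[OF assms(1), of f, OF f]
      by (simp add: has_bochner_integral_iff N_def f_def)
  qed
  have "has_bochner_integral N (\<lambda>x. 2 * (\<Prod>i\<in>I. 1 - indicator A (x i)) +
      (\<Sum>j\<in>I. \<Prod>i\<in>I. if i = j then indicator A (x i) else 1 - indicator A (x i)))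
      (2 * (1 - prob A) ^ card I + (\<Sum>j\<in>I. prob A * (1 - prob A) ^ (card I - 1)))"
    using 1 2 by (intro has_bochner_integral_add has_bochner_integral_mult_right has_bochner_integral_sum) auto
  moreover have "max 0 (2 - (\<Sum>i\<in>I. indicator A (x i))) = 2 * (\<Prod>i\<in>I. 1 - indicator A (x i)) +
      (\<Sum>j\<in>I. \<Prod>i\<in>I. if i = j then indicator A (x i) else 1 - indicator A (x i) :: real)" for x
    using assms(1) by (intro max_zero_two_minus_sum) (auto simp: indicator_def)
  ultimately have *: "has_bochner_integral N (\<lambda>x. max 0 (2 - (\<Sum>i\<in>I. indicator A (x i)))) (void_mean (card I) (prob A))"
    by (simp add: void_mean_def mult.assoc)
  show ?thesis
    unfolding N_def[symmetric] has_bochner_integral_integral_eq[OF *, symmetric]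
    by (intro nn_integral_eq_integral integrable.intros[OF *]) simp
qed

section \<open>The uniform distribution on the unit square\<close>

abbreviation unif :: "(real^2) measure" where
  "unif \<equiv> uniform_measure lborel (cbox 0 1)"

lemma emeasure_unit_square: "emeasure lborel (cbox 0 (1 :: real^2)) = 1"
  by (subst emeasure_lborel_cbox) (auto simp: Basis_vec_def inner_axis intro!: prod.neutral)

lemma prob_space_unif: "prob_space unif"
  by (intro prob_space_uniform_measure) (auto simp: emeasure_unit_square)

text \<open>The density is at most 1. Both lower bounds dispose of the boundary of the square
  through this estimate.\<close>

lemma nn_integral_unif_le:
  assumes "f \<in> borel_measurable borel"
  shows "(\<integral>\<^sup>+x. f x \<partial>unif) \<le> (\<integral>\<^sup>+x. f x \<partial>lborel)"
proof -
  have "(\<integral>\<^sup>+x. f x \<partial>unif) = (\<integral>\<^sup>+x. f x * indicator (cbox 0 1) x \<partial>lborel)"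
    using assms by (subst nn_integral_uniform_measure) (auto simp: emeasure_unit_square divide_ennreal_def)
  also have "\<dots> \<le> (\<integral>\<^sup>+x. f x \<partial>lborel)"
    by (intro nn_integral_mono) (auto simp: indicator_def)
  finally show ?thesis .
qed

lemma measure_unif_cball_le:
  assumes "r \<ge> 0"
  shows "measure unif (cball c r) \<le> pi * r\<^sup>2"
proof -
  interpret prob_space unif by (rule prob_space_unif)
  have "emeasure unif (cball c r) = (\<integral>\<^sup>+x. indicator (cball c r) x \<partial>unif)" by simp
  also have "\<dots> \<le> (\<integral>\<^sup>+x. indicator (cball c r) x \<partial>lborel)"
    by (intro nn_integral_unif_le borel_measurable_indicator) auto
  also have "\<dots> = ennreal (pi * r\<^sup>2)"
    using assms by (simp add: emeasure_cball unit_ball_vol_2)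
  finally show ?thesis by (simp add: emeasure_eq_measure)
qed

text \<open>Fubini with the centre integrated last: for a fixed centre \<open>y\<close> the number
  of other points in \<open>cball y r\<close> is binomial, and its success probability is at most
  the area of the disc.\<close>

lemma PiM_unif_void_mean_le:
  assumes "finite I" "v \<notin> I" "r \<ge> 0" "pi * r\<^sup>2 \<le> 1"
  shows "ennreal (void_mean (card I) (pi * r\<^sup>2)) \<le>
    (\<integral>\<^sup>+x. ennreal (max 0 (2 - (\<Sum>w\<in>I. of_bool (norm (x v - x w) \<le> r))))
       \<partial>PiM (insert v I) (\<lambda>_. unif))"
proof -
  interpret U: prob_space unif by (rule prob_space_unif)
  interpret product_prob_space "\<lambda>_. unif" I by standard
  define f where "f = (\<lambda>x :: 'a \<Rightarrow> real^2. ennreal (max 0 (2 - (\<Sum>w\<in>I. of_bool (norm (x v - x w) \<le> r)))))"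
  have "f \<in> borel_measurable (PiM (insert v I) (\<lambda>_. borel :: (real^2) measure))"
    unfolding f_def by measurable
  then have f: "f \<in> borel_measurable (PiM (insert v I) (\<lambda>_. unif))"
    using measurable_cong_sets[OF sets_PiM_cong[of "insert v I" "insert v I" "\<lambda>_. borel :: (real^2) measure" "\<lambda>_. unif"] refl, of borel]
    by simp
  have "f (x(v := y)) = ennreal (max 0 (2 - (\<Sum>w\<in>I. indicator (cball y r) (x w))))" for x y
    using assms(2) unfolding f_def
    by (intro arg_cong[of _ _ ennreal] arg_cong[of _ _ "max 0"] arg_cong2[of _ _ _ _ minus] refl sum.cong)
       (auto simp: indicator_def dist_norm)
  then have *: "(\<integral>\<^sup>+x. f (x(v := y)) \<partial>PiM I (\<lambda>_. unif)) = ennreal (void_mean (card I) (U.prob (cball y r)))" for y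
    using U.PiM_integral_max_zero_two_minus[OF assms(1), of "cball y r"] by simp
  have "ennreal (void_mean (card I) (pi * r\<^sup>2)) = (\<integral>\<^sup>+y. ennreal (void_mean (card I) (pi * r\<^sup>2)) \<partial>unif)"
    by (simp only: nn_integral_const U.emeasure_space_1 mult_1_right)
  also have "\<dots> \<le> (\<integral>\<^sup>+y. (\<integral>\<^sup>+x. f (x(v := y)) \<partial>PiM I (\<lambda>_. unif)) \<partial>unif)"
    unfolding *
    using measure_unif_cball_le[OF assms(3)] assms(4)
    by (intro nn_integral_mono ennreal_leI void_mean_antimono) auto
  also have "\<dots> = (\<integral>\<^sup>+x. f x \<partial>PiM (insert v I) (\<lambda>_. unif))"
    using product_nn_integral_insert_rev[OF assms(1,2) f] by simp
  finally show ?thesis unfolding f_def .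
qed

section \<open>Exponential moments of rectilinear path lengths\<close>

lemma nn_integral_exp_abs:
  assumes "\<theta> > 0"
  shows "(\<integral>\<^sup>+y. ennreal (exp (- (\<theta> * \<bar>y - c\<bar>))) \<partial>lborel) = ennreal (2 / \<theta>)"
proof -
  interpret E: prob_space "density lborel (exponential_density \<theta>)"
    using assms by (rule prob_space_exponential_density)
  define f where "f = (\<lambda>y. ennreal (exp (- (\<theta> * \<bar>y\<bar>))))"
  have f[measurable]: "f \<in> borel_measurable borel" unfolding f_def by measurable
  \<comment> \<open>Read off from the total mass 1 of the exponential density; reflection then gives
    the other half-line, and translation the centre \<open>c\<close>.\<close>
  have half: "(\<integral>\<^sup>+y. f y * indicator {0..} y \<partial>lborel) = ennreal (1 / \<theta>)"
  proof -
    have "1 = (\<integral>\<^sup>+y. ennreal (exponential_density \<theta> y) \<partial>lborel)"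
      using E.emeasure_space_1 by (simp add: emeasure_density)
    also have "\<dots> = (\<integral>\<^sup>+y. ennreal \<theta> * (f y * indicator {0..} y) \<partial>lborel)"
      using assms by (intro nn_integral_cong)
        (auto simp: f_def exponential_density_def ennreal_mult[symmetric] indicator_def mult.commute)
    also have "\<dots> = ennreal \<theta> * (\<integral>\<^sup>+y. f y * indicator {0..} y \<partial>lborel)"
      by (intro nn_integral_cmult) auto
    finally have "ennreal (1 / \<theta>) * 1 = ennreal (1 / \<theta>) * (ennreal \<theta> * (\<integral>\<^sup>+y. f y * indicator {0..} y \<partial>lborel))"
      by simp
    then show ?thesis using assms by (simp add: mult.assoc[symmetric] ennreal_mult[symmetric])
  qed
  have "(\<integral>\<^sup>+y. f y \<partial>lborel) = (\<integral>\<^sup>+y. f y * indicator {0..} y + f y * indicator {..0} y \<partial>lborel)"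
    using AE_lborel_singleton[of "0::real"]
    by (intro nn_integral_cong_AE) (auto simp: indicator_def)
  also have "\<dots> = (\<integral>\<^sup>+y. f y * indicator {0..} y \<partial>lborel) + (\<integral>\<^sup>+y. f y * indicator {..0} y \<partial>lborel)"
    by (intro nn_integral_add) auto
  also have "(\<integral>\<^sup>+y. f y * indicator {..0} y \<partial>lborel) = (\<integral>\<^sup>+y. f y * indicator {0..} y \<partial>lborel)"
    using nn_integral_real_affine[of "\<lambda>y. f y * indicator {..0} y" "-1" 0]
    by (auto intro!: nn_integral_cong simp: f_def indicator_def)
  finally have "(\<integral>\<^sup>+y. f y \<partial>lborel) = ennreal (2 / \<theta>)"
    using assms by (simp add: half ennreal_plus[symmetric] del: ennreal_plus)
  moreover have "(\<integral>\<^sup>+y. f y \<partial>lborel) = (\<integral>\<^sup>+y. f (y - c) \<partial>lborel)"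
    using nn_integral_real_affine[of f 1 "- c"] by simp
  ultimately show ?thesis by (simp add: f_def)
qed

text \<open>For the rectilinear norm the integrand is a product over the two coordinates, hence the
  square of \<open>2 / \<theta>\<close>. The constant 1/(2e) depends on the truck norm through this
  value.\<close>

lemma nn_integral_exp_l1_norm:
  assumes "\<theta> > 0"
  shows "(\<integral>\<^sup>+y. ennreal (exp (- (\<theta> * l1_norm (y - c)))) \<partial>lborel) = ennreal (4 / \<theta>\<^sup>2)"
proof -
  have l1: "l1_norm p = (\<Sum>b\<in>Basis. \<bar>p \<bullet> b\<bar>)" for p :: "real^2"
  proof -
    have B: "Basis = range (\<lambda>i. axis i 1 :: real^2)" by (auto simp: Basis_vec_def)
    have "inj (\<lambda>i. axis i 1 :: real^2)" by (simp add: inj_def axis_eq_axis)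
    then show ?thesis unfolding B l1_norm_def by (subst sum.reindex) (auto simp: inner_axis)
  qed
  have "(\<integral>\<^sup>+y. ennreal (exp (- (\<theta> * l1_norm (y - c)))) \<partial>lborel)
      = (\<integral>\<^sup>+y. (\<Prod>b\<in>Basis. ennreal (exp (- (\<theta> * \<bar>y \<bullet> b - c \<bullet> b\<bar>)))) \<partial>lborel)"
    by (intro nn_integral_cong)
      (simp add: l1 prod_ennreal exp_sum[symmetric] sum_negf sum_distrib_left inner_diff_left)
  also have "\<dots> = (\<Prod>b\<in>(Basis::(real^2) set). ennreal (2 / \<theta>))"
    by (subst nn_integral_lborel_prod) (auto simp: nn_integral_exp_abs[OF assms])
  also have "\<dots> = ennreal (4 / \<theta>\<^sup>2)"
    using assms by (simp add: ennreal_power power_divide)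
  finally show ?thesis .
qed

lemma l1_norm_measurable [measurable]: "l1_norm \<in> borel_measurable borel"
  unfolding l1_norm_def by measurable

lemma path_length_map_measurable:
  assumes "set is \<subseteq> I" and [measurable]: "N \<in> borel_measurable borel"
  shows "(\<lambda>x. path_length N (map x is)) \<in> borel_measurable (PiM I (\<lambda>_. borel))"
  using assms(1)
proof (induction "is" rule: induct_list012)
  case (3 i j js)
  then have [measurable]: "i \<in> I" "j \<in> I"
    and IH[measurable]: "(\<lambda>x. path_length N (map x (j # js))) \<in> borel_measurable (PiM I (\<lambda>_. borel))"
    by auto
  have "(\<lambda>x. N (x i - x j) + path_length N (map x (j # js))) \<in> borel_measurable (PiM I (\<lambda>_. borel))"
    by measurable
  then show ?case by simp
qed simp_all

text \<open>The edges of a path are dependent, but integrating out its first point affects one edge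
  only, and the factor \<open>4 / \<theta>\<^sup>2\<close> is uniform in the position of the next
  point.\<close>

lemma PiM_unif_exp_path_length_le:
  assumes "distinct (i # is)" "\<theta> > 0"
  shows "(\<integral>\<^sup>+x. ennreal (exp (- (\<theta> * path_length l1_norm (map x (i # is)))))
      \<partial>PiM (set (i # is)) (\<lambda>_. unif)) \<le> ennreal ((4 / \<theta>\<^sup>2) ^ length is)"
  using assms(1)
proof (induction "is" arbitrary: i)
  case Nil
  interpret U: prob_space unif by (rule prob_space_unif)
  interpret P: prob_space "PiM {i} (\<lambda>_. unif)" by (intro prob_space_PiM U.prob_space_axioms)
  show ?case by (simp add: P.emeasure_space_1)
next
  case (Cons j js)
  interpret U: prob_space unif by (rule prob_space_unif)
  interpret product_prob_space "\<lambda>_. unif" UNIV by standard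
  define J where "J = set (j # js)"
  define f where "f = (\<lambda>x. ennreal (exp (- (\<theta> * path_length l1_norm (map x (i # j # js))))))"
  define g where "g = (\<lambda>x. ennreal (exp (- (\<theta> * path_length l1_norm (map x (j # js))))))"
  have J: "finite J" "i \<notin> J" "insert i J = set (i # j # js)" using Cons.prems by (auto simp: J_def)
  have sets: "sets (PiM I (\<lambda>_. unif)) = sets (PiM I (\<lambda>_. borel))" for I :: "'a set"
    by (intro sets_PiM_cong) auto
  have f: "f \<in> borel_measurable (PiM (insert i J) (\<lambda>_. unif))"
    using path_length_map_measurable[of "i # j # js" "insert i J" l1_norm] J(3)
    unfolding f_def measurable_cong_sets[OF sets refl] by simp
  have g: "g \<in> borel_measurable (PiM J (\<lambda>_. unif))"
    using path_length_map_measurable[of "j # js" J l1_norm]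
    unfolding g_def measurable_cong_sets[OF sets refl] J_def by simp
  have fg: "f (x(i := y)) = ennreal (exp (- (\<theta> * l1_norm (y - x j)))) * g x" for x y
  proof -
    have "map (x(i := y)) (j # js) = map x (j # js)" using Cons.prems by (intro map_cong) auto
    then show ?thesis using Cons.prems
      by (simp add: f_def g_def ennreal_mult'[symmetric] exp_add[symmetric] algebra_simps)
  qed
  have "(\<integral>\<^sup>+x. f x \<partial>PiM (insert i J) (\<lambda>_. unif))
      = (\<integral>\<^sup>+x. (\<integral>\<^sup>+y. f (x(i := y)) \<partial>unif) \<partial>PiM J (\<lambda>_. unif))"
    by (rule product_nn_integral_insert[OF J(1,2) f])
  also have "\<dots> \<le> (\<integral>\<^sup>+x. ennreal (4 / \<theta>\<^sup>2) * g x \<partial>PiM J (\<lambda>_. unif))"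
  proof (intro nn_integral_mono)
    fix x
    have "(\<integral>\<^sup>+y. f (x(i := y)) \<partial>unif) = (\<integral>\<^sup>+y. ennreal (exp (- (\<theta> * l1_norm (y - x j)))) \<partial>unif) * g x"
      unfolding fg by (intro nn_integral_multc) (simp add: measurable_cong_sets[of unif borel])
    also have "\<dots> \<le> ennreal (4 / \<theta>\<^sup>2) * g x"
      using nn_integral_unif_le[of "\<lambda>y. ennreal (exp (- (\<theta> * l1_norm (y - x j))))"]
        nn_integral_exp_l1_norm[OF assms(2), of "x j"]
      by (intro mult_right_mono) auto
    finally show "(\<integral>\<^sup>+y. f (x(i := y)) \<partial>unif) \<le> ennreal (4 / \<theta>\<^sup>2) * g x" .
  qed
  also have "\<dots> = ennreal (4 / \<theta>\<^sup>2) * (\<integral>\<^sup>+x. g x \<partial>PiM J (\<lambda>_. unif))"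
    using g by (rule nn_integral_cmult)
  also have "\<dots> \<le> ennreal (4 / \<theta>\<^sup>2) * ennreal ((4 / \<theta>\<^sup>2) ^ length js)"
    using Cons.IH[of j] Cons.prems unfolding g_def J_def by (intro mult_left_mono) auto
  also have "\<dots> = ennreal ((4 / \<theta>\<^sup>2) ^ length (j # js))"
    by (simp add: ennreal_mult'[symmetric])
  finally show ?case unfolding f_def J(3) .
qed

section \<open>From product measures to the random sample\<close>

lemma (in prob_space) nn_integral_unif_sample:
  assumes indep: "indep_vars (\<lambda>_. borel) X UNIV"
    and distr: "\<And>i. distr M borel (X i) = unif"
    and I: "I \<noteq> {}" and f: "f \<in> borel_measurable (PiM I (\<lambda>_. borel))"
  shows "(\<integral>\<^sup>+\<omega>. f (\<lambda>i\<in>I. X i \<omega>) \<partial>M) = (\<integral>\<^sup>+x. f x \<partial>PiM I (\<lambda>_. unif))"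
proof -
  have rv[measurable]: "random_variable borel (X i)" for i
    using indep by (simp add: indep_vars_def)
  have "indep_vars (\<lambda>_. borel) X I"
    using indep by (rule indep_vars_subset) simp
  then have "distr M (PiM I (\<lambda>_. borel)) (\<lambda>\<omega>. \<lambda>i\<in>I. X i \<omega>) = PiM I (\<lambda>_. unif)"
    using indep_vars_iff_distr_eq_PiM[where M' = "\<lambda>_. borel", OF I rv] distr by simp
  moreover have "(\<integral>\<^sup>+\<omega>. f (\<lambda>i\<in>I. X i \<omega>) \<partial>M)
      = (\<integral>\<^sup>+x. f x \<partial>distr M (PiM I (\<lambda>_. borel)) (\<lambda>\<omega>. \<lambda>i\<in>I. X i \<omega>))"
    using f by (subst nn_integral_distr) (auto intro!: measurable_restrict)
  ultimately show ?thesis by simp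
qed

lemma (in prob_space) unif_sample_void_mean_le:
  assumes indep: "indep_vars (\<lambda>_. borel) X UNIV"
    and distr: "\<And>i. distr M borel (X i) = unif"
    and I: "finite I" "v \<notin> I" and r: "r \<ge> 0" "pi * r\<^sup>2 \<le> 1"
  shows "void_mean (card I) (pi * r\<^sup>2) \<le>
    expectation (\<lambda>\<omega>. max 0 (2 - (\<Sum>w\<in>I. of_bool (norm (X v \<omega> - X w \<omega>) \<le> r))))"
proof -
  define f where "f = (\<lambda>x :: _ \<Rightarrow> real^2. max 0 (2 - (\<Sum>w\<in>I. of_bool (norm (x v - x w) \<le> r))) :: real)"
  have [measurable]: "f \<in> borel_measurable (PiM (insert v I) (\<lambda>_. borel))"
    unfolding f_def by measurable
  have [measurable]: "random_variable borel (X i)" for i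
    using indep by (simp add: indep_vars_def)
  have f_bounds: "0 \<le> f x" "f x \<le> 2" for x
  proof -
    have "0 \<le> (\<Sum>w\<in>I. of_bool (norm (x v - x w) \<le> r) :: real)" by (intro sum_nonneg) auto
    then show "f x \<le> 2" by (simp add: f_def)
  qed (simp add: f_def)
  have eq: "f (\<lambda>i\<in>insert v I. X i \<omega>) = f (\<lambda>i. X i \<omega>)" for \<omega>
    by (simp add: f_def cong: sum.cong)
  have [measurable]: "(\<lambda>\<omega>. f (\<lambda>i. X i \<omega>)) \<in> borel_measurable M"
    unfolding f_def by measurable
  have int: "integrable M (\<lambda>\<omega>. f (\<lambda>i. X i \<omega>))"
    using f_bounds by (intro integrable_const_bound[where B = 2]) auto
  have "ennreal (void_mean (card I) (pi * r\<^sup>2)) \<le> (\<integral>\<^sup>+x. f x \<partial>PiM (insert v I) (\<lambda>_. unif))"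
    unfolding f_def using I r by (rule PiM_unif_void_mean_le)
  also have "\<dots> = (\<integral>\<^sup>+\<omega>. f (\<lambda>i\<in>insert v I. X i \<omega>) \<partial>M)"
    by (rule nn_integral_unif_sample[symmetric, OF indep distr]) auto
  also have "\<dots> = ennreal (expectation (\<lambda>\<omega>. f (\<lambda>i. X i \<omega>)))"
    unfolding eq using int f_bounds by (intro nn_integral_eq_integral) auto
  finally have "void_mean (card I) (pi * r\<^sup>2) \<le> expectation (\<lambda>\<omega>. f (\<lambda>i. X i \<omega>))"
    using f_bounds by (subst (asm) ennreal_le_iff) (auto intro: Bochner_Integration.integral_nonneg)
  then show ?thesis unfolding f_def .
qed

lemma (in prob_space) unif_sample_exp_path_length_le:
  assumes indep: "indep_vars (\<lambda>_. borel) X UNIV"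
    and distr: "\<And>i. distr M borel (X i) = unif"
    and "is": "distinct is" "is \<noteq> []" and "\<theta> > 0"
  shows "(\<integral>\<^sup>+\<omega>. ennreal (exp (- (\<theta> * path_length l1_norm (map (\<lambda>i. X i \<omega>) is)))) \<partial>M)
    \<le> ennreal ((4 / \<theta>\<^sup>2) ^ (length is - 1))"
proof -
  obtain i js where ij: "is = i # js" using "is"(2) by (cases "is") auto
  define f where "f = (\<lambda>x. ennreal (exp (- (\<theta> * path_length l1_norm (map x is)))))"
  have [measurable]: "(\<lambda>x. path_length l1_norm (map x is)) \<in> borel_measurable (PiM (set is) (\<lambda>_. borel))"
    by (rule path_length_map_measurable) auto
  have f: "f \<in> borel_measurable (PiM (set is) (\<lambda>_. borel))"
    unfolding f_def by measurable
  have *: "map (\<lambda>i\<in>set is. X i \<omega>) is = map (\<lambda>i. X i \<omega>) is" for \<omega>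
    by (intro map_cong) auto
  have "(\<integral>\<^sup>+\<omega>. ennreal (exp (- (\<theta> * path_length l1_norm (map (\<lambda>i. X i \<omega>) is)))) \<partial>M)
      = (\<integral>\<^sup>+\<omega>. f (\<lambda>i\<in>set is. X i \<omega>) \<partial>M)"
    unfolding f_def * ..
  also have "\<dots> = (\<integral>\<^sup>+x. f x \<partial>PiM (set is) (\<lambda>_. unif))"
    using "is" by (intro nn_integral_unif_sample[OF indep distr _ f]) auto
  also have "\<dots> \<le> ennreal ((4 / \<theta>\<^sup>2) ^ (length is - 1))"
    using PiM_unif_exp_path_length_le[of i js \<theta>] "is" assms(5) by (simp add: f_def ij)
  finally show ?thesis .
qed

text \<open>
  A coincidence of two points has $\ell_1$-distance $0$, so the exponential moment bound gives it
  probability at most $4/\theta^2$ for every $\theta$.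
\<close>

lemma (in prob_space) AE_inj_unif_sample:
  assumes indep: "indep_vars (\<lambda>_. borel) X (UNIV :: 'i :: countable set)"
    and distr: "\<And>i. distr M borel (X i) = unif"
  shows "AE \<omega> in M. inj (\<lambda>i. X i \<omega>)"
proof -
  have [measurable]: "random_variable borel (X i)" for i
    using indep by (simp add: indep_vars_def)
  have "AE \<omega> in M. X i \<omega> \<noteq> X j \<omega>" if ij: "i \<noteq> j" for i j
  proof -
    define S where "S = {\<omega> \<in> space M. X i \<omega> = X j \<omega>}"
    have S: "S \<in> events" unfolding S_def by measurable
    have le: "prob S \<le> 4 / \<theta>\<^sup>2" if "\<theta> > 0" for \<theta>
    proof -
      have "ennreal (prob S) = (\<integral>\<^sup>+\<omega>. indicator S \<omega> \<partial>M)"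
        using S by (simp add: emeasure_eq_measure)
      also have "\<dots> \<le> (\<integral>\<^sup>+\<omega>. ennreal (exp (- (\<theta> * path_length l1_norm (map (\<lambda>i. X i \<omega>) [i, j])))) \<partial>M)"
        by (intro nn_integral_mono) (auto simp: indicator_def S_def l1_norm_def)
      also have "\<dots> \<le> ennreal (4 / \<theta>\<^sup>2)"
        using unif_sample_exp_path_length_le[OF indep distr, of "[i, j]" \<theta>] ij that by simp
      finally show ?thesis by simp
    qed
    have "prob S = 0"
    proof (rule ccontr)
      assume "prob S \<noteq> 0"
      then have "prob S > 0" by (simp add: zero_less_measure_iff)
      \<comment> \<open>For this value \<open>4 / \<theta>\<^sup>2\<close> is half of
        \<open>prob S\<close>.\<close>
      then show False using le[of "sqrt (8 / prob S)"] by simp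
    qed
    then have "AE \<omega> in M. \<omega> \<notin> S" using S prob_eq_0 by blast
    then show ?thesis by (rule AE_mp) (auto simp: S_def)
  qed
  then have "AE \<omega> in M. \<forall>i j. i \<noteq> j \<longrightarrow> X i \<omega> \<noteq> X j \<omega>"
    by (simp add: AE_all_countable)
  then show ?thesis by (rule AE_mp) (auto simp: inj_def)
qed

section \<open>Passing from means to almost sure limits\<close>

lemma (in prob_space) limit_expectation_le:
  fixes W :: "nat \<Rightarrow> 'a \<Rightarrow> real"
  assumes [measurable]: "\<And>n. W n \<in> borel_measurable M"
    and bounded: "\<And>n \<omega>. \<bar>W n \<omega>\<bar> \<le> C"
    and le: "AE \<omega> in M. \<forall>\<^sub>F n in sequentially. W n \<omega> \<le> b n \<omega>"
    and lim: "AE \<omega> in M. (\<lambda>n. b n \<omega>) \<longlonglongrightarrow> B"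
    and L: "\<forall>\<^sub>F n in sequentially. L n \<le> expectation (W n)" "L \<longlonglongrightarrow> l"
  shows "l \<le> B"
proof -
  \<comment> \<open>Convergence of \<open>W n\<close> itself is not given; its positive excess over
    \<open>B\<close> does tend to 0, being squeezed by that of \<open>b n \<omega>\<close>, and it
    is bounded.\<close>
  define g where "g = (\<lambda>n \<omega>. max (W n \<omega> - B) 0)"
  have [measurable]: "g n \<in> borel_measurable M" for n unfolding g_def by measurable
  have g_bounded: "norm (g n \<omega>) \<le> C + \<bar>B\<bar>" for n \<omega>
    using bounded[of n \<omega>] by (auto simp: g_def)
  have "AE \<omega> in M. (\<lambda>n. g n \<omega>) \<longlonglongrightarrow> 0"
    using le lim
  proof eventually_elim
    case (elim \<omega>)
    have "(\<lambda>n. max (b n \<omega> - B) 0) \<longlonglongrightarrow> max (B - B) 0"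
      by (intro tendsto_intros elim)
    then have b: "(\<lambda>n. max (b n \<omega> - B) 0) \<longlonglongrightarrow> 0" by simp
    have g: "\<forall>\<^sub>F n in sequentially. g n \<omega> \<le> max (b n \<omega> - B) 0"
      using elim(1) by eventually_elim (auto simp: g_def)
    have "\<forall>\<^sub>F n in sequentially. 0 \<le> g n \<omega>" by (simp add: g_def)
    then show ?case by (rule tendsto_sandwich[OF _ g tendsto_const b])
  qed
  then have "(\<lambda>n. expectation (g n)) \<longlonglongrightarrow> expectation (\<lambda>_. 0)"
    using g_bounded by (intro integral_dominated_convergence[where w = "\<lambda>_. C + \<bar>B\<bar>"]) auto
  then have lim_g: "(\<lambda>n. B + expectation (g n)) \<longlonglongrightarrow> B + 0"
    by (intro tendsto_intros) simp
  have ev: "\<forall>\<^sub>F n in sequentially. L n \<le> B + expectation (g n)"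
    using L(1)
  proof eventually_elim
    case (elim n)
    have int: "integrable M (W n)" "integrable M (g n)"
      using bounded g_bounded
      by (intro integrable_const_bound[where B = C] integrable_const_bound[where B = "C + \<bar>B\<bar>"]; simp)+
    have "expectation (W n) \<le> expectation (\<lambda>\<omega>. B + g n \<omega>)"
      using int by (intro integral_mono) (auto simp: g_def)
    also have "\<dots> = B + expectation (g n)"
      using int by (simp add: prob_space)
    finally show ?case using elim by simp
  qed
  show ?thesis using tendsto_le[OF _ lim_g L(2) ev] by simp
qed

text \<open>Fatou's lemma takes the place of a Borel-Cantelli argument, so it suffices that the
  means tend to 0.\<close>

lemma (in prob_space) not_AE_eventually_ge_one:
  fixes S :: "nat \<Rightarrow> 'a \<Rightarrow> ennreal"
  assumes [measurable]: "\<And>n. S n \<in> borel_measurable M"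
    and ge: "AE \<omega> in M. \<forall>\<^sub>F n in sequentially. 1 \<le> S n \<omega>"
    and lim: "(\<lambda>n. \<integral>\<^sup>+\<omega>. S n \<omega> \<partial>M) \<longlonglongrightarrow> 0"
  shows False
proof -
  have "1 = (\<integral>\<^sup>+\<omega>. 1 \<partial>M)" by (simp add: emeasure_space_1)
  also have "\<dots> \<le> (\<integral>\<^sup>+\<omega>. liminf (\<lambda>n. S n \<omega>) \<partial>M)"
    using ge by (intro nn_integral_mono_AE) (auto elim!: eventually_mono intro: Liminf_bounded)
  also have "\<dots> \<le> liminf (\<lambda>n. \<integral>\<^sup>+\<omega>. S n \<omega> \<partial>M)"
    by (intro nn_integral_liminf) auto
  also have "\<dots> = 0" using lim by (intro lim_imp_Liminf) auto
  finally show False by simp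
qed

section \<open>Limits\<close>

text \<open>The Poisson limit: a Poisson variable of mean \<open>x\<close> is 0 with probability
  \<open>exp (- x)\<close>, which counts twice, and 1 with probability
  \<open>x * exp (- x)\<close>.\<close>

lemma void_mean_tendsto:
  "(\<lambda>n. void_mean (n - 1) (x / real n)) \<longlonglongrightarrow> exp (- x) * (2 + x)"
proof -
  have e: "(\<lambda>n. (1 - x / real n) ^ n) \<longlonglongrightarrow> exp (- x)"
    using tendsto_exp_limit_sequentially[of "- x"] by simp
  have d: "(\<lambda>n. 1 - x / real n) \<longlonglongrightarrow> 1" by real_asymp
  have m: "(\<lambda>n. real (n - 1) * (x / real n)) \<longlonglongrightarrow> x" by real_asymp
  \<comment> \<open>The powers with exponents \<open>n - 1\<close> and \<open>n - 2\<close> are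
    written as the \<open>n\<close>-th power divided by factors tending to 1.\<close>
  have "(\<lambda>n. 2 * ((1 - x / real n) ^ n / (1 - x / real n))
      + real (n - 1) * (x / real n) * ((1 - x / real n) ^ n / (1 - x / real n) ^ 2))
      \<longlonglongrightarrow> 2 * (exp (- x) / 1) + x * (exp (- x) / 1 ^ 2)"
    by (intro tendsto_intros e d m) auto
  moreover have "\<forall>\<^sub>F n in sequentially. 2 * ((1 - x / real n) ^ n / (1 - x / real n))
      + real (n - 1) * (x / real n) * ((1 - x / real n) ^ n / (1 - x / real n) ^ 2)
      = void_mean (n - 1) (x / real n)"
    using order_tendstoD(1)[OF d zero_less_one] eventually_ge_at_top[of 2]
  proof eventually_elim
    case (elim n)
    obtain m where n: "n = Suc (Suc m)" using elim(2) by (metis le_add_diff_inverse add_2_eq_Suc)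
    define y where "y = 1 - x / real n"
    have "y \<noteq> 0" using elim(1) by (simp only: y_def)
    then have "y ^ n / y = y ^ (n - 1)" "y ^ n / y ^ 2 = y ^ (n - 1 - 1)"
      by (simp_all add: n power2_eq_square)
    then show ?case unfolding void_mean_def y_def[symmetric] by simp
  qed
  ultimately show ?thesis
    by (auto simp: algebra_simps intro: Lim_transform_eventually)
qed

lemma gaussian_antiderivative:
  obtains E :: "real \<Rightarrow> real" where "\<And>x. DERIV E x :> exp (- (pi * x\<^sup>2))" "E 0 = 0" "(E \<longlongrightarrow> 1 / 2) at_top"
proof -
  define e where "e = (\<lambda>x::real. exp (- (pi * x\<^sup>2)))"
  have cont: "isCont e x" for x unfolding e_def by (intro continuous_intros)
  obtain E0 where E0: "\<And>x. (E0 has_vector_derivative e x) (at x)"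
    using einterval_antiderivative[of "-\<infinity>" \<infinity> e] cont by auto
  define E where "E = (\<lambda>x. E0 x - E0 0)"
  have E: "DERIV E x :> e x" for x
    using E0[of x] unfolding E_def has_real_derivative_iff_has_vector_derivative
    by (auto intro!: derivative_eq_intros)
  define f where "f = (\<lambda>x. indicator {0..} x *\<^sub>R e x)"
  \<comment> \<open>Scaling by \<open>sqrt pi\<close> turns the half-line Gaussian integral
    \<open>sqrt pi / 2\<close> into 1/2.\<close>
  have "has_bochner_integral lborel (\<lambda>x. indicator {0..} (0 + sqrt pi * x) *\<^sub>R exp (- (0 + sqrt pi * x)\<^sup>2))
    ((sqrt pi / 2) /\<^sub>R \<bar>sqrt pi\<bar>)"
    by (rule iffD1[OF lborel_has_bochner_integral_real_affine_iff gaussian_moment_0]) simp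
  moreover have "(\<lambda>x. indicator {0..} (0 + sqrt pi * x) *\<^sub>R exp (- (0 + sqrt pi * x)\<^sup>2)) = f"
    using pi_gt_zero
    by (auto simp: f_def e_def fun_eq_iff indicator_def power_mult_distrib zero_le_mult_iff
        simp del: pi_gt_zero)
  moreover have "(sqrt pi / 2) /\<^sub>R \<bar>sqrt pi\<bar> = 1 / 2" by simp
  ultimately have f: "has_bochner_integral lborel f (1 / 2)" by metis
  have "((\<lambda>t. \<integral>x. indicator {..t} x *\<^sub>R f x \<partial>lborel) \<longlongrightarrow> integral\<^sup>L lborel f) at_top"
    using f by (intro tendsto_integral_at_top) (auto simp: has_bochner_integral_iff)
  moreover have "integral\<^sup>L lborel f = 1 / 2" using f by (simp add: has_bochner_integral_iff)
  moreover have "\<forall>\<^sub>F t in at_top. (\<integral>x. indicator {..t} x *\<^sub>R f x \<partial>lborel) = E t"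
    using eventually_ge_at_top[of 0]
  proof eventually_elim
    case (elim t)
    have "(\<integral>x. indicator {..t} x *\<^sub>R f x \<partial>lborel) = (\<integral>x. e x * indicator {0..t} x \<partial>lborel)"
      by (intro Bochner_Integration.integral_cong) (auto simp: f_def indicator_def)
    also have "\<dots> = E t - E 0"
      using elim E cont by (intro integral_FTC_Icc_real) auto
    finally show ?case by (simp add: E_def)
  qed
  ultimately have "(E \<longlongrightarrow> 1 / 2) at_top" by (auto intro: Lim_transform_eventually)
  then show thesis using E by (intro that[of E]) (simp_all add: e_def E_def)
qed

text \<open>By the mean value theorem each increment of \<open>F\<close> is \<open>h\<close> times
  an interior value of \<open>f\<close>, which the value at the left end dominates.\<close>

lemma antimono_sum_ge_antiderivative:
  fixes F f :: "real \<Rightarrow> real"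
  assumes F: "\<And>x. 0 \<le> x \<Longrightarrow> DERIV F x :> f x"
    and f: "\<And>x y. 0 \<le> x \<Longrightarrow> x \<le> y \<Longrightarrow> f y \<le> f x" and "h > 0"
  shows "F (real n * h) - F 0 \<le> h * (\<Sum>j<n. f (real j * h))"
proof (induction n)
  case (Suc n)
  have "\<exists>z. real n * h < z \<and> z < real (Suc n) * h \<and>
      F (real (Suc n) * h) - F (real n * h) = (real (Suc n) * h - real n * h) * f z"
  proof (intro MVT2 F)
    show "real n * h < real (Suc n) * h" using \<open>h > 0\<close> by simp
    show "0 \<le> x" if "real n * h \<le> x" for x
      using that \<open>h > 0\<close> by (meson less_eq_real_def mult_nonneg_nonneg of_nat_0_le_iff order_trans)
  qed
  then obtain z where z: "real n * h < z" "F (real (Suc n) * h) - F (real n * h) = h * f z"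
    by (auto simp: algebra_simps)
  have "f z \<le> f (real n * h)" using z(1) \<open>h > 0\<close> by (intro f) auto
  then have "h * f z \<le> h * f (real n * h)" using \<open>h > 0\<close> by simp
  then show ?case using Suc z(2) by (simp add: distrib_left)
qed simp

lemma five_quarters_le_of_riemann_sums:
  assumes "\<And>\<epsilon> J. \<epsilon> > 0 \<Longrightarrow>
    \<epsilon> * (\<Sum>j=1..J. exp (- (pi * (real j * \<epsilon>)\<^sup>2)) * (2 + pi * (real j * \<epsilon>)\<^sup>2)) \<le> b"
  shows "5 / 4 \<le> b"
proof -
  obtain E :: "real \<Rightarrow> real" where E: "\<And>x. DERIV E x :> exp (- (pi * x\<^sup>2))" "E 0 = 0"
    "(E \<longlongrightarrow> 1 / 2) at_top"
    using gaussian_antiderivative by blast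
  define f where "f = (\<lambda>x. exp (- (pi * x\<^sup>2)) * (2 + pi * x\<^sup>2))"
  \<comment> \<open>The derivative of \<open>x / 2 * exp (- (pi * x\<^sup>2))\<close> is
    \<open>(1 / 2 - pi * x\<^sup>2) * exp (- (pi * x\<^sup>2))\<close>, so subtracting that term
    from \<open>5 / 2 * E x\<close> produces the factor \<open>2 + pi * x\<^sup>2\<close>.\<close>
  define F where "F = (\<lambda>x. 5 / 2 * E x - x / 2 * exp (- (pi * x\<^sup>2)))"
  have F: "DERIV F x :> f x" for x
    unfolding F_def f_def
    by (auto intro!: derivative_eq_intros E(1) simp: field_simps power2_eq_square)
  have f_mono: "f y \<le> f x" if "0 \<le> x" "x \<le> y" for x y
  proof -
    have "exp (- v) * (2 + v) \<le> exp (- u) * (2 + u)" if "0 \<le> u" "u \<le> v" for u v :: real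
    proof (rule DERIV_nonpos_imp_nonincreasing[OF that(2)])
      fix w assume w: "u \<le> w" "w \<le> v"
      have "DERIV (\<lambda>w. exp (- w) * (2 + w)) w :> - (exp (- w) * (1 + w))"
        by (auto intro!: derivative_eq_intros simp: algebra_simps)
      moreover have "- (exp (- w) * (1 + w)) \<le> 0" using w that by simp
      ultimately show "\<exists>y. DERIV (\<lambda>w. exp (- w) * (2 + w)) w :> y \<and> y \<le> 0" by blast
    qed
    then show ?thesis using that by (simp add: f_def power_mono)
  qed
  \<comment> \<open>With mesh \<open>1 / N\<close> and about \<open>N ^ 2\<close> terms the mesh
    shrinks while the range of integration grows to infinity. The summand \<open>2 / N\<close> is
    the term at 0, absent from the assumed sums.\<close>
  have le: "F (real (Suc (N ^ 2)) * (1 / real N)) \<le> b + 2 / real N" if "N > 0" for N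
  proof -
    have "F (real (Suc (N ^ 2)) * (1 / real N)) - F 0
        \<le> 1 / real N * (\<Sum>j<Suc (N ^ 2). f (real j * (1 / real N)))"
      using that by (intro antimono_sum_ge_antiderivative F f_mono) auto
    also have "(\<Sum>j<Suc (N ^ 2). f (real j * (1 / real N))) = f 0 + (\<Sum>j=1..N ^ 2. f (real j * (1 / real N)))"
      by (subst sum.lessThan_Suc_shift) (simp add: sum.atLeast1_atMost_eq)
    also have "1 / real N * \<dots> = 2 / real N + 1 / real N * (\<Sum>j=1..N ^ 2. f (real j * (1 / real N)))"
      by (simp add: f_def distrib_left)
    also have "\<dots> \<le> 2 / real N + b"
      using assms[of "1 / real N" "N ^ 2"] that unfolding f_def by simp
    finally show ?thesis by (simp add: F_def E(2))
  qed
  have "((\<lambda>x::real. x / 2 * exp (- (pi * x\<^sup>2))) \<longlongrightarrow> 0) at_top" by real_asymp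
  then have "(F \<longlongrightarrow> 5 / 2 * (1 / 2) - 0) at_top"
    unfolding F_def by (intro tendsto_intros E)
  moreover have "filterlim (\<lambda>N. real (Suc (N ^ 2)) * (1 / real N)) at_top sequentially"
    by real_asymp
  ultimately have lim_F: "(\<lambda>N. F (real (Suc (N ^ 2)) * (1 / real N))) \<longlonglongrightarrow> 5 / 2 * (1 / 2) - 0"
    by (rule filterlim_compose)
  have lim_b: "(\<lambda>N. b + 2 / real N) \<longlonglongrightarrow> b" by real_asymp
  have "\<forall>\<^sub>F N in sequentially. F (real (Suc (N ^ 2)) * (1 / real N)) \<le> b + 2 / real N"
    using eventually_gt_at_top[of 0] le by (rule eventually_mono)
  then show ?thesis using tendsto_le[OF _ lim_b lim_F] by simp
qed

text \<open>A path through half of \<open>n\<close> points, rounded up, has \<open>k n\<close>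
  edges. The base of the power approaches \<open>2 * exp 1 * c < 1\<close>, so the decay is
  geometric.\<close>

lemma path_count_bound_tendsto_0:
  assumes "c > 0" "c < 1 / (2 * exp 1)"
  defines "k \<equiv> \<lambda>n. (n + 1) div 2 - 1"
  shows "(\<lambda>n. real n * (exp 1 * c * real n / real (k n)) ^ (2 * k n)) \<longlonglongrightarrow> 0"
proof -
  define a where "a = exp 1 * c"
  \<comment> \<open>The midpoint between the limiting base \<open>2 * a\<close> and 1.\<close>
  define q where "q = (1 + 2 * a) / 2"
  have a: "a > 0" "2 * a < 1" using assms by (auto simp: a_def field_simps)
  then have q: "0 < q" "q < 1" "a < q / 2" by (auto simp: q_def)
  have "filterlim (\<lambda>n. (q / 2 - a) * real n) at_top sequentially"
    using q by real_asymp
  \<comment> \<open>A rearrangement of \<open>a * n \<le> q * (n / 2 - 1)\<close>, where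
    \<open>n / 2 - 1\<close> bounds \<open>k n\<close> from below.\<close>
  then have ev: "\<forall>\<^sub>F n in sequentially. q \<le> (q / 2 - a) * real n"
    by (simp add: filterlim_at_top)
  have le: "\<forall>\<^sub>F n in sequentially. real n * (a * real n / real (k n)) ^ (2 * k n) \<le> real n * q ^ n / q ^ 2"
    using ev eventually_ge_at_top[of 3]
  proof eventually_elim
    case (elim n)
    have k: "real n / 2 - 1 \<le> real (k n)" "k n > 0" "n \<le> 2 * k n + 2"
      using elim(2) by (auto simp: k_def)
    have "q * (real n / 2 - 1) \<le> q * real (k n)" using k q by (intro mult_left_mono) auto
    then have "a * real n \<le> q * real (k n)" using elim(1) by (simp add: algebra_simps)
    then have "a * real n / real (k n) \<le> q" using k by (simp add: field_simps)
    then have "(a * real n / real (k n)) ^ (2 * k n) \<le> q ^ (2 * k n)"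
      using a k by (intro power_mono) auto
    also have "\<dots> = q ^ (2 * k n + 2) / q ^ 2" using q by (simp add: power_add power2_eq_square)
    also have "\<dots> \<le> q ^ n / q ^ 2"
      using q k by (intro divide_right_mono power_decreasing) auto
    finally have "real n * (a * real n / real (k n)) ^ (2 * k n) \<le> real n * (q ^ n / q ^ 2)"
      by (intro mult_left_mono) auto
    then show ?case by simp
  qed
  have lim: "(\<lambda>n. real n * q ^ n / q ^ 2) \<longlonglongrightarrow> 0"
    using tendsto_divide[OF powser_times_n_limit_0[of q] tendsto_const[of "q ^ 2"]] q by simp
  have ge: "\<forall>\<^sub>F n in sequentially. 0 \<le> real n * (a * real n / real (k n)) ^ (2 * k n)"
    using a by (intro always_eventually allI mult_nonneg_nonneg zero_le_power divide_nonneg_nonneg) auto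
  show ?thesis
    using tendsto_sandwich[OF ge le tendsto_const lim] unfolding a_def .
qed

section \<open>The lower bounds\<close>

text \<open>
  If $N(r)$ counts the other points within distance $r$ of $p$, then $\max(0, 2 - N(r))$ is the number
  of $i \in \{1, 2\}$ such that the $i$-th nearest neighbour of $p$ is farther away than $r$; so its
  integral over $r$ is the sum of the two smallest distances.  Truncated Riemann sums of this integral
  replace that sum, because they are bounded on the scale $1/\sqrt n$ whatever the points are.
\<close>

definition void_excess :: "(real^2) set \<Rightarrow> real^2 \<Rightarrow> real \<Rightarrow> real" where
  "void_excess P p r = max 0 (2 - (\<Sum>q\<in>P - {p}. of_bool (norm (p - q) \<le> r)))"

text \<open>Since the sum starts at 1, it is a lower Riemann sum for the indicator of
  \<open>[0, t)\<close>.\<close>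

lemma sum_multiples_below_le:
  assumes "\<delta> > 0" "t \<ge> 0"
  shows "\<delta> * (\<Sum>j=1..J. of_bool (real j * \<delta> < t)) \<le> t"
proof -
  have "{j \<in> {1..J}. real j * \<delta> < t} \<subseteq> {1..nat \<lfloor>t / \<delta>\<rfloor>}"
    using assms by (auto simp: le_nat_iff le_floor_iff pos_le_divide_eq)
  then have "card {j \<in> {1..J}. real j * \<delta> < t} \<le> card {1..nat \<lfloor>t / \<delta>\<rfloor>}"
    by (intro card_mono) auto
  then have "real (card {j \<in> {1..J}. real j * \<delta> < t}) \<le> t / \<delta>"
    using assms by (simp add: le_nat_iff le_floor_iff)
  moreover have "(\<Sum>j=1..J. of_bool (real j * \<delta> < t)) = real (card {j \<in> {1..J}. real j * \<delta> < t})"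
    by (subst sum_of_bool_eq) (auto simp: Int_def)
  ultimately show ?thesis using assms by (simp add: field_simps)
qed

text \<open>Counting only \<open>a\<close> and \<open>b\<close> can only enlarge the excess, so the
  two nearest neighbours never have to be singled out.\<close>

lemma void_excess_sum_le:
  assumes "finite P" "a \<in> P" "b \<in> P" "a \<noteq> b" "a \<noteq> p" "b \<noteq> p" "\<delta> > 0"
  shows "\<delta> * (\<Sum>j=1..J. void_excess P p (real j * \<delta>)) \<le> norm (p - a) + norm (p - b)"
proof -
  have "void_excess P p r \<le> of_bool (r < norm (p - a)) + of_bool (r < norm (p - b))" for r
  proof -
    have "(\<Sum>q\<in>{a, b}. of_bool (norm (p - q) \<le> r)) \<le> (\<Sum>q\<in>P - {p}. of_bool (norm (p - q) \<le> r) :: real)"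
      using assms by (intro sum_mono2) auto
    then show ?thesis using assms(4) by (auto simp: void_excess_def split: if_splits)
  qed
  then have "(\<Sum>j=1..J. void_excess P p (real j * \<delta>))
    \<le> (\<Sum>j=1..J. of_bool (real j * \<delta> < norm (p - a)) + of_bool (real j * \<delta> < norm (p - b)))"
    by (intro sum_mono) auto
  then have "\<delta> * (\<Sum>j=1..J. void_excess P p (real j * \<delta>))
    \<le> \<delta> * (\<Sum>j=1..J. of_bool (real j * \<delta> < norm (p - a))) + \<delta> * (\<Sum>j=1..J. of_bool (real j * \<delta> < norm (p - b)))"
    using assms(7) by (simp add: sum.distrib distrib_left[symmetric] del: sum_of_bool_eq)
  also have "\<dots> \<le> norm (p - a) + norm (p - b)"
    using assms(7) by (intro add_mono sum_multiples_below_le) auto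
  finally show ?thesis .
qed

lemma sum_void_excess_le_rect_eucl_tspd:
  assumes "finite P" "card P \<ge> 5" "\<alpha> \<ge> 1" "\<delta> > 0"
  shows "(\<Sum>p\<in>P. \<delta> * (\<Sum>j=1..J. void_excess P p (real j * \<delta>))) \<le> (\<alpha> + 2) * rect_eucl_tspd \<alpha> P"
  unfolding rect_eucl_tspd_def
proof (rule sum_neighbour_bound_le_tspd)
  show "norm p \<le> l1_norm p" for p :: "real^2"
    by (simp add: l1_norm_def norm_le_l1_cart)
  show "0 \<le> \<delta> * (\<Sum>j=1..J. void_excess P p (real j * \<delta>))" for p
    using assms by (intro mult_nonneg_nonneg sum_nonneg) (auto simp: void_excess_def)
  show "\<delta> * (\<Sum>j=1..J. void_excess P p (real j * \<delta>)) \<le> norm (p - a) + norm (p - b)"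
    if "{p, a, b} \<subseteq> P" "a \<noteq> b" "a \<noteq> p" "b \<noteq> p" for p a b
    using that assms by (intro void_excess_sum_le) auto
qed (use assms in auto)

lemma void_excess_image:
  assumes "inj_on x I" "v \<in> I"
  shows "void_excess (x ` I) (x v) r = max 0 (2 - (\<Sum>w\<in>I - {v}. of_bool (norm (x v - x w) \<le> r)))"
proof -
  have "x ` I - {x v} = x ` (I - {v})" using assms by (auto dest: inj_onD)
  moreover have "inj_on x (I - {v})" using assms(1) by (rule inj_on_subset) auto
  ultimately show ?thesis by (simp add: void_excess_def sum.reindex del: sum_of_bool_eq)
qed

text \<open>With mesh \<open>\<epsilon> / sqrt n\<close> the disc areas are constants divided by
  \<open>n\<close>, which is the Poisson regime, and the normalised sum stays below
  \<open>2 * \<epsilon> * J\<close> for every sample. For this reason \<open>\<epsilon>\<close> and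
  \<open>J\<close> are fixed while \<open>n\<close> grows.\<close>

lemma (in prob_space) rect_eucl_riemann_sum_le:
  assumes \<alpha>: "\<alpha> \<ge> 1"
    and indep: "indep_vars (\<lambda>_. borel) X UNIV"
    and distr: "\<And>i. distr M borel (X i) = unif"
    and lim: "AE \<omega> in M. (\<lambda>n. rect_eucl_tspd \<alpha> ((\<lambda>i. X i \<omega>) ` {..<n}) / sqrt (real n)) \<longlonglongrightarrow> \<beta>"
    and \<epsilon>: "\<epsilon> > 0"
  shows "\<epsilon> * (\<Sum>j=1..J. exp (- (pi * (real j * \<epsilon>)\<^sup>2)) * (2 + pi * (real j * \<epsilon>)\<^sup>2)) \<le> (\<alpha> + 2) * \<beta>"
proof -
  have [measurable]: "random_variable borel (X i)" for i
    using indep by (simp add: indep_vars_def)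
  define r where "r = (\<lambda>n j. real j * (\<epsilon> / sqrt (real n)))"
  define Y where "Y = (\<lambda>n v j \<omega>.
    max 0 (2 - (\<Sum>w\<in>{..<n} - {v}. of_bool (norm (X v \<omega> - X w \<omega>) \<le> r n j))) :: real)"
  have [measurable]: "Y n v j \<in> borel_measurable M" for n v j
    unfolding Y_def by measurable
  have Y: "0 \<le> Y n v j \<omega>" "Y n v j \<omega> \<le> 2" for n v j \<omega>
  proof -
    have "0 \<le> (\<Sum>w\<in>{..<n} - {v}. of_bool (norm (X v \<omega> - X w \<omega>) \<le> r n j) :: real)"
      by (intro sum_nonneg) auto
    then show "Y n v j \<omega> \<le> 2" by (simp add: Y_def)
  qed (simp add: Y_def)
  \<comment> \<open>The factor combines the mesh \<open>\<epsilon> / sqrt n\<close> with the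
    normalisation \<open>1 / sqrt n\<close>.\<close>
  define W where "W = (\<lambda>n \<omega>. \<epsilon> / real n * (\<Sum>v<n. \<Sum>j=1..J. Y n v j \<omega>))"
  have r2: "pi * (r n j)\<^sup>2 = pi * (real j * \<epsilon>)\<^sup>2 / real n" for n j
    by (simp add: r_def power_mult_distrib power_divide)
  show ?thesis
  proof (rule limit_expectation_le[of W "2 * \<epsilon> * real J"
        "\<lambda>n \<omega>. (\<alpha> + 2) * (rect_eucl_tspd \<alpha> ((\<lambda>i. X i \<omega>) ` {..<n}) / sqrt (real n))" _
        "\<lambda>n. \<epsilon> * (\<Sum>j=1..J. void_mean (n - 1) (pi * (real j * \<epsilon>)\<^sup>2 / real n))"])
    show "W n \<in> borel_measurable M" for n unfolding W_def by measurable
    show "\<bar>W n \<omega>\<bar> \<le> 2 * \<epsilon> * real J" for n \<omega>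
    proof -
      have "0 \<le> W n \<omega>" using Y \<epsilon> unfolding W_def by (intro mult_nonneg_nonneg sum_nonneg) auto
      moreover have "(\<Sum>v<n. \<Sum>j=1..J. Y n v j \<omega>) \<le> (\<Sum>v<n. \<Sum>j=1..J. 2)"
        using Y by (intro sum_mono) auto
      then have "W n \<omega> \<le> \<epsilon> / real n * (real n * (real J * 2))"
        using \<epsilon> unfolding W_def by (intro mult_left_mono) auto
      moreover have "\<epsilon> / real n * (real n * (real J * 2)) \<le> 2 * \<epsilon> * real J"
        using \<epsilon> by (cases "n = 0") auto
      ultimately show ?thesis by linarith
    qed
    show "AE \<omega> in M. \<forall>\<^sub>F n in sequentially. W n \<omega> \<le>
        (\<alpha> + 2) * (rect_eucl_tspd \<alpha> ((\<lambda>i. X i \<omega>) ` {..<n}) / sqrt (real n))"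
      using AE_inj_unif_sample[OF indep distr]
    proof eventually_elim
      case inj: (elim \<omega>)
      show ?case using eventually_ge_at_top[of 5]
      proof eventually_elim
        case (elim n)
        define x where "x = (\<lambda>i. X i \<omega>)"
        define P where "P = x ` {..<n}"
        define \<delta> where "\<delta> = \<epsilon> / sqrt (real n)"
        have \<delta>: "\<delta> > 0" using \<epsilon> elim by (simp add: \<delta>_def)
        have inj': "inj_on x {..<n}" using inj unfolding x_def by (rule inj_on_subset) auto
        have "(\<Sum>p\<in>P. \<delta> * (\<Sum>j=1..J. void_excess P p (real j * \<delta>))) \<le> (\<alpha> + 2) * rect_eucl_tspd \<alpha> P"
          using \<alpha> \<delta> elim inj' by (intro sum_void_excess_le_rect_eucl_tspd) (auto simp: P_def card_image)
        moreover have "(\<Sum>p\<in>P. \<delta> * (\<Sum>j=1..J. void_excess P p (real j * \<delta>)))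
            = (\<Sum>v<n. \<delta> * (\<Sum>j=1..J. void_excess P (x v) (real j * \<delta>)))"
          unfolding P_def by (subst sum.reindex[OF inj']) simp
        moreover have "void_excess P (x v) (real j * \<delta>) = Y n v j \<omega>" if "v < n" for v j
          using void_excess_image[OF inj', of v] that by (simp add: P_def Y_def x_def r_def \<delta>_def)
        ultimately have "\<delta> * (\<Sum>v<n. \<Sum>j=1..J. Y n v j \<omega>) \<le> (\<alpha> + 2) * rect_eucl_tspd \<alpha> P"
          by (simp add: sum_distrib_left)
        then have "\<delta> * (\<Sum>v<n. \<Sum>j=1..J. Y n v j \<omega>) / sqrt (real n)
            \<le> (\<alpha> + 2) * rect_eucl_tspd \<alpha> P / sqrt (real n)"
          by (intro divide_right_mono) auto
        moreover have "\<delta> * (\<Sum>v<n. \<Sum>j=1..J. Y n v j \<omega>) / sqrt (real n) = W n \<omega>"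
          by (simp add: \<delta>_def W_def)
        ultimately show ?case by (simp add: P_def x_def)
      qed
    qed
    show "AE \<omega> in M. (\<lambda>n. (\<alpha> + 2) * (rect_eucl_tspd \<alpha> ((\<lambda>i. X i \<omega>) ` {..<n}) / sqrt (real n)))
        \<longlonglongrightarrow> (\<alpha> + 2) * \<beta>"
      using lim by eventually_elim (intro tendsto_mult tendsto_const)
    show "(\<lambda>n. \<epsilon> * (\<Sum>j=1..J. void_mean (n - 1) (pi * (real j * \<epsilon>)\<^sup>2 / real n)))
      \<longlonglongrightarrow> \<epsilon> * (\<Sum>j=1..J. exp (- (pi * (real j * \<epsilon>)\<^sup>2)) * (2 + pi * (real j * \<epsilon>)\<^sup>2))"
      by (intro tendsto_mult tendsto_const tendsto_sum void_mean_tendsto)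
    \<comment> \<open>Areas must be at most 1 to act as probabilities in \<open>void_mean\<close>;
      finitely many \<open>j\<close> permit a common threshold for \<open>n\<close>.\<close>
    have "\<forall>\<^sub>F n in sequentially. \<forall>j\<in>{1..J}. pi * (real j * \<epsilon>)\<^sup>2 / real n \<le> 1"
    proof (intro eventually_ball_finite ballI)
      fix j
      have "(\<lambda>n. pi * (real j * \<epsilon>)\<^sup>2 / real n) \<longlonglongrightarrow> 0" by real_asymp
      then show "\<forall>\<^sub>F n in sequentially. pi * (real j * \<epsilon>)\<^sup>2 / real n \<le> 1"
        by (intro eventually_mono[OF order_tendstoD(2)[of _ 0 _ 1]]) auto
    qed simp
    then show "\<forall>\<^sub>F n in sequentially.
      \<epsilon> * (\<Sum>j=1..J. void_mean (n - 1) (pi * (real j * \<epsilon>)\<^sup>2 / real n)) \<le> expectation (W n)"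
      using eventually_gt_at_top[of 0]
    proof eventually_elim
      case (elim n)
      have int: "integrable M (Y n v j)" for v j
        using Y by (intro integrable_const_bound[where B = 2]) auto
      have "void_mean (n - 1) (pi * (real j * \<epsilon>)\<^sup>2 / real n) \<le> expectation (Y n v j)"
        if "v < n" "j \<in> {1..J}" for v j
        using unif_sample_void_mean_le[OF indep distr, of "{..<n} - {v}" v "r n j"] that elim \<epsilon>
        unfolding Y_def r2 by (simp add: r_def)
      then have "(\<Sum>v<n. \<Sum>j=1..J. void_mean (n - 1) (pi * (real j * \<epsilon>)\<^sup>2 / real n))
          \<le> (\<Sum>v<n. \<Sum>j=1..J. expectation (Y n v j))"
        by (intro sum_mono) auto
      then have "\<epsilon> / real n * (\<Sum>v<n. \<Sum>j=1..J. void_mean (n - 1) (pi * (real j * \<epsilon>)\<^sup>2 / real n))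
          \<le> \<epsilon> / real n * (\<Sum>v<n. \<Sum>j=1..J. expectation (Y n v j))"
        using \<epsilon> by (intro mult_left_mono) auto
      also have "\<dots> = expectation (W n)"
        unfolding W_def using int by (simp add: Bochner_Integration.integral_sum)
      finally show ?case using elim(2) by simp
    qed
  qed
qed

section \<open>The path-counting bound\<close>

lemma l1_norm_nonneg: "0 \<le> l1_norm p"
  by (simp add: l1_norm_def sum_nonneg)

lemma (in prob_space) rect_eucl_path_count_bound:
  assumes indep: "indep_vars (\<lambda>_. borel) X UNIV"
    and distr: "\<And>i. distr M borel (X i) = unif"
    and lim: "AE \<omega> in M. (\<lambda>n. rect_eucl_tspd \<alpha> ((\<lambda>i. X i \<omega>) ` {..<n}) / sqrt (real n)) \<longlonglongrightarrow> \<beta>"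
  shows "1 / (2 * exp 1) \<le> \<beta>"
proof (rule ccontr)
  assume "\<not> ?thesis"
  \<comment> \<open>The maximum with 0 makes \<open>c\<close> positive, as \<open>\<theta>\<close>
    divides by it.\<close>
  then have "max 0 \<beta> < 1 / (2 * exp 1)" by simp
  then obtain c where c: "max 0 \<beta> < c" "c < 1 / (2 * exp 1)" using dense by blast
  have [measurable]: "random_variable borel (X i)" for i
    using indep by (simp add: indep_vars_def)
  define k where "k = (\<lambda>n::nat. (n + 1) div 2 - 1)"
  \<comment> \<open>This choice of \<open>\<theta>\<close> minimises the Chernoff bound \<open>exp (\<theta> * a) * (4 / \<theta>\<^sup>2) ^ k\<close> at \<open>a = c * sqrt n\<close>.\<close>
  define \<theta> where "\<theta> = (\<lambda>n. 2 * real (k n) / (c * sqrt (real n)))"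
  \<comment> \<open>Index lists of one common length, half of \<open>n\<close> rounded up: every
    truck tour visits at least that many nodes and is cut down to them.\<close>
  define paths where "paths = (\<lambda>n. {is. set is \<subseteq> {..<n} \<and> distinct is \<and> length is = Suc (k n)})"
  define len where "len = (\<lambda>is \<omega>. path_length l1_norm (map (\<lambda>i. X i \<omega>) is))"
  \<comment> \<open>Markov's inequality and the union bound in one function: a summand is at least 1
    as soon as its path has length at most \<open>c * sqrt n\<close>.\<close>
  define S where "S = (\<lambda>n \<omega>. \<Sum>is\<in>paths n. ennreal (exp (\<theta> n * (c * sqrt (real n)))) * ennreal (exp (- (\<theta> n * len is \<omega>))))"
  have paths: "finite (paths n)" "card (paths n) \<le> n ^ Suc (k n)" for n
  proof -
    have "paths n \<subseteq> {is. set is \<subseteq> {..<n} \<and> length is = Suc (k n)}" by (auto simp: paths_def)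
    then show "finite (paths n)" "card (paths n) \<le> n ^ Suc (k n)"
      using finite_lists_length_eq[of "{..<n}" "Suc (k n)"] card_lists_length_eq[of "{..<n}" "Suc (k n)"]
        card_mono[of "{is. set is \<subseteq> {..<n} \<and> length is = Suc (k n)}" "paths n"]
      by (auto intro: finite_subset)
  qed
  have [measurable]: "len is \<in> borel_measurable M" for "is"
    unfolding len_def by (induction "is" rule: induct_list012) simp_all
  have "S n \<in> borel_measurable M" for n unfolding S_def by measurable
  moreover have "AE \<omega> in M. \<forall>\<^sub>F n in sequentially. 1 \<le> S n \<omega>"
    using AE_inj_unif_sample[OF indep distr] lim
  proof eventually_elim
    case \<omega>: (elim \<omega>)
    have "\<beta> < c" using c by simp
    show ?case
      using order_tendstoD(2)[OF \<omega>(2) \<open>\<beta> < c\<close>] eventually_ge_at_top[of 2]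
    proof eventually_elim
      case (elim n)
      define x where "x = (\<lambda>i. X i \<omega>)"
      define P where "P = x ` {..<n}"
      have "inj_on x {..<n}" using \<omega>(1) unfolding x_def by (rule inj_on_subset) auto
      then have card: "card P = n" by (simp add: P_def card_image)
      have fin: "finite P" by (simp add: P_def)
      have card2: "card P \<ge> 2" using card elim(2) by simp
      obtain C where C: "distinct C" "set C \<subseteq> P" "card P \<le> 2 * length C"
        "path_length l1_norm C \<le> tspd l1_norm (\<lambda>p. norm p / \<alpha>) P"
        by (rule tspd_truck_tour[OF fin card2 l1_norm_nonneg])
      define C' where "C' = take (Suc (k n)) C"
      have len': "length C' = Suc (k n)"
        using C(3) card elim(2) by (auto simp: C'_def k_def)
      have "C' \<in> lists (x ` {..<n})"
        using C(2) set_take_subset[of "Suc (k n)" C] unfolding C'_def P_def by blast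
      then obtain "is" where "is": "C' = map x is" "set is \<subseteq> {..<n}"
        unfolding lists_image by (auto simp: lists_eq_set)
      have "distinct C'" using C(1) by (simp add: C'_def)
      then have mem: "is \<in> paths n" using "is" len' by (auto simp: paths_def distinct_map)
      have "len is \<omega> = path_length l1_norm C'" by (simp add: len_def "is" x_def)
      also have "\<dots> \<le> path_length l1_norm C"
        using path_length_append_ge[of l1_norm C' "drop (Suc (k n)) C"]
        by (simp add: C'_def l1_norm_nonneg)
      also have "\<dots> \<le> c * sqrt (real n)"
        using C(4) elim by (simp add: rect_eucl_tspd_def P_def x_def field_simps)
      finally have "\<theta> n * len is \<omega> \<le> \<theta> n * (c * sqrt (real n))"
        using c by (intro mult_left_mono) (auto simp: \<theta>_def)
      then have "ennreal 1 \<le> ennreal (exp (\<theta> n * (c * sqrt (real n))) * exp (- (\<theta> n * len is \<omega>)))"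
        by (intro ennreal_leI) (simp add: exp_add[symmetric])
      also have "\<dots> \<le> S n \<omega>"
        unfolding S_def ennreal_mult'[OF exp_ge_zero] using paths mem by (intro member_le_sum) auto
      finally show ?case by simp
    qed
  qed
  moreover have "(\<lambda>n. \<integral>\<^sup>+\<omega>. S n \<omega> \<partial>M) \<longlonglongrightarrow> 0"
  proof -
    define b where "b = (\<lambda>n. real n * (exp 1 * c * real n / real (k n)) ^ (2 * k n))"
    have "b \<longlonglongrightarrow> 0"
      unfolding b_def k_def using c by (intro path_count_bound_tendsto_0) auto
    then have lim_b: "(\<lambda>n. ennreal (b n)) \<longlonglongrightarrow> ennreal 0" by (rule tendsto_ennrealI)
    have le: "\<forall>\<^sub>F n in sequentially. (\<integral>\<^sup>+\<omega>. S n \<omega> \<partial>M) \<le> ennreal (b n)"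
      \<comment> \<open>From three points on, a path has at least one edge, so
        \<open>\<theta> n\<close> is positive.\<close>
      using eventually_ge_at_top[of 3]
    proof eventually_elim
      case (elim n)
      have kn: "k n > 0" using elim by (auto simp: k_def)
      have \<theta>: "\<theta> n > 0" using c kn elim by (simp add: \<theta>_def)
      have "\<theta> n * (c * sqrt (real n)) = real (2 * k n)" using c elim by (simp add: \<theta>_def)
      then have e: "exp (\<theta> n * (c * sqrt (real n))) = exp 1 ^ (2 * k n)"
        by (simp add: exp_of_nat_mult[symmetric])
      have t: "4 / (\<theta> n)\<^sup>2 = c\<^sup>2 * real n / (real (k n))\<^sup>2"
        using elim by (simp add: \<theta>_def power_divide power_mult_distrib)
      have "(\<integral>\<^sup>+\<omega>. S n \<omega> \<partial>M) = (\<Sum>is\<in>paths n. ennreal (exp 1 ^ (2 * k n)) *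
          (\<integral>\<^sup>+\<omega>. ennreal (exp (- (\<theta> n * len is \<omega>))) \<partial>M))"
        unfolding S_def e by (subst nn_integral_sum) (auto simp: nn_integral_cmult)
      also have "\<dots> \<le> (\<Sum>is\<in>paths n. ennreal (exp 1 ^ (2 * k n)) * ennreal ((4 / (\<theta> n)\<^sup>2) ^ k n))"
      proof (intro sum_mono mult_left_mono)
        fix "is" assume "is \<in> paths n"
        then have "is": "distinct is" "is \<noteq> []" "length is - 1 = k n" by (auto simp: paths_def)
        show "(\<integral>\<^sup>+\<omega>. ennreal (exp (- (\<theta> n * len is \<omega>))) \<partial>M) \<le> ennreal ((4 / (\<theta> n)\<^sup>2) ^ k n)"
          using unif_sample_exp_path_length_le[OF indep distr "is"(1,2) \<theta>] "is"(3)
          unfolding len_def by simp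
      qed simp
      also have "\<dots> = ennreal (real (card (paths n)) * (exp 1 ^ (2 * k n) * (4 / (\<theta> n)\<^sup>2) ^ k n))"
        by (simp add: ennreal_mult'[symmetric] ennreal_of_nat_eq_real_of_nat)
      also have "\<dots> \<le> ennreal (real (n ^ Suc (k n)) * (exp 1 ^ (2 * k n) * (4 / (\<theta> n)\<^sup>2) ^ k n))"
        using paths(2)[of n] by (intro ennreal_leI mult_right_mono) (auto simp del: power_Suc of_nat_power)
      also have "real (n ^ Suc (k n)) * (exp 1 ^ (2 * k n) * (4 / (\<theta> n)\<^sup>2) ^ k n) = b n"
      proof -
        define e m K where "e = exp (1::real)" and "m = real n" and "K = real (k n)"
        \<comment> \<open>Of the \<open>n ^ Suc (k n)\<close> paths, the factor
          \<open>n ^ k n\<close> is absorbed into the power, which leaves the single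
          \<open>n\<close> in \<open>b\<close>.\<close>
        have "(e * c * m / K) ^ 2 = m * (e ^ 2 * (c ^ 2 * m / K ^ 2))"
          by (simp add: power2_eq_square)
        then have "(e * c * m / K) ^ (2 * k n) = m ^ k n * (e ^ (2 * k n) * (c ^ 2 * m / K ^ 2) ^ k n)"
          by (simp only: power_mult power_mult_distrib)
        then show ?thesis unfolding t b_def e_def m_def K_def by simp
      qed
      finally show ?case .
    qed
    have "\<forall>\<^sub>F n in sequentially. 0 \<le> (\<integral>\<^sup>+\<omega>. S n \<omega> \<partial>M)" by simp
    then show ?thesis using tendsto_sandwich[OF _ le tendsto_const] lim_b by simp
  qed
  ultimately show False by (rule not_AE_eventually_ge_one)
qed

theorem theorem6:
  fixes \<alpha> \<beta> :: real and M :: "'a measure" and X :: "nat \<Rightarrow> 'a \<Rightarrow> real^2"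
  assumes "\<alpha> \<ge> 1"
    and "prob_space M"
    and "prob_space.indep_vars M (\<lambda>_. borel) X UNIV"
    and "\<And>i. distr M borel (X i) = uniform_measure lborel (cbox 0 1)"
    and "AE \<omega> in M. (\<lambda>n. rect_eucl_tspd \<alpha> ((\<lambda>i. X i \<omega>) ` {..<n}) / sqrt (real n)) \<longlonglongrightarrow> \<beta>"
    and "(\<lambda>n. prob_space.expectation M
               (\<lambda>\<omega>. rect_eucl_tspd \<alpha> ((\<lambda>i. X i \<omega>) ` {..<n}) / sqrt (real n))) \<longlonglongrightarrow> \<beta>"
  shows "\<beta> \<ge> max (5 / (4 * (\<alpha> + 2))) (1 / (2 * exp 1))"
proof -
  interpret prob_space M by fact
  have "5 / 4 \<le> (\<alpha> + 2) * \<beta>"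
    by (rule five_quarters_le_of_riemann_sums) (rule rect_eucl_riemann_sum_le[OF assms(1,3-5)])
  then have "5 / (4 * (\<alpha> + 2)) \<le> \<beta>" using assms(1) by (simp add: field_simps)
  then show ?thesis using rect_eucl_path_count_bound[OF assms(3-5)] by simp
qed

end
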